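(* Let $\pi$ be an irreducible representation of $G=\mathrm{GL}_4(\mathfrak{o}_2)$ whose orbit contains $\beta_2=\begin{pmatrix}\eta&0\\0&\eta\end{pmatrix}$. Let $\tilde\psi_{\beta_2}$ be a representation of $G(\psi_{\beta_2})$ with $\tilde\psi_{\beta_2}|_{K_1}=\psi_{\beta_2}$, and let $\rho=\theta\otimes\tilde\psi_{\beta_2}$, with $\theta$ an irreducible representation of $G(\psi_{\beta_2})$ pulled back from a representation of $G(\psi_{\beta_2})/K_1$, be the representation of $G(\psi_{\beta_2})$, uniquely determined by $\pi$, such that $\pi=\mathrm{Ind}_{G(\psi_{\beta_2})}^{G}\rho$. Then $\pi$ is cuspidal if and only if the restriction of $\rho$ to $G(\psi_{\beta_2})\cap U_{2,2}$ does not contain the trivial representation of $G(\psi_{\beta_2})\cap U_{2,2}$.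
   Context: All representations are finite-dimensional and complex. $F$ is an arbitrary (non-archimedean) local field with ring of integers $\mathfrak{o}$, maximal ideal $\mathfrak{p}$ and finite residue field $\mathbb{F}_q$; $\mathfrak{o}_2=\mathfrak{o}/\mathfrak{p}^2$, $G=\mathrm{GL}_4(\mathfrak{o}_2)$, and $K_1$ is the kernel of the reduction map $G\to \mathrm{GL}_4(\mathbb{F}_q)$. Let $\eta$ be an element generating the extension $\mathbb{F}_{q^2}/\mathbb{F}_q$. Embed $\mathbb{F}_{q^2}\hookrightarrow M_2(\mathbb{F}_q)$ via its action on itself by multiplication, using the $\mathbb{F}_q$-basis $\{1,\eta\}$ of $\mathbb{F}_{q^2}$; this gives an embedding $M_2(\mathbb{F}_{q^2})\subset M_4(\mathbb{F}_q)$ (entries become $2\times 2$ blocks), through which $\beta_2$ is viewed as an element of $M_4(\mathbb{F}_q)$. Orbit. Fix an additive character $\psi$ of $\mathfrak{o}$ with conductor $\mathfrak{p}^2$ (trivial on $\mathfrak{p}^2$, non-trivial on $\mathfrak{p}$). For $\beta\in M_4(\mathbb{F}_q)$ define the character $\psi_\beta:K_1\to\mathbb{C}^\times$ by $\psi_\beta(x)=\psi(\mathrm{Tr}(\beta(x-1)))$ (computed with any lift of $\beta$ to $M_4(\mathfrak{o}_2)$). Every character of the abelian group $K_1$ is of this form for a unique $\beta$. For an irreducible representation $\pi$ of $G$, the set of $\beta$ such that $\psi_\beta$ occurs in $\pi|_{K_1}$ is a single $\mathrm{GL}_4(\mathbb{F}_q)$-conjugacy class in $M_4(\mathbb{F}_q)$,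 called the orbit of $\pi$. $G(\psi_\beta)$ denotes the stabilizer in $G$ of $\psi_\beta$ under the conjugation action of $G$ on characters of $K_1$; it is the preimage in $G$ of the centralizer of $\beta$ in $\mathrm{GL}_4(\mathbb{F}_q)$. It is known (Hill) that $\psi_{\beta_2}$ extends to a representation $\tilde\psi_{\beta_2}$ of $G(\psi_{\beta_2})$ as in the claim, and that every irreducible representation $\pi$ of $G$ whose orbit contains $\beta_2$ is of the form $\mathrm{Ind}_{G(\psi_{\beta_2})}^{G}\rho$ with $\rho=\theta\otimes\tilde\psi_{\beta_2}$ as in the claim, where $\rho$ is uniquely determined by $\pi$. Geometric induction. For $(i,j)\in\{(1,3),(2,2),(3,1)\}$, let $U_{i,j}\subset G$ be the group of block matrices $\begin{pmatrix} I_i & *\\ 0& I_j\end{pmatrix}$ over $\mathfrak{o}_2$. Infinitesimal induction. For each partition $\lambda\in\{(2,1^3),(2^2,1^2),(2^3,1)\}$, let $M_\lambda=\bigoplus_i \mathfrak{o}/\mathfrak{p}^{\lambda_i}$, embedded as a submodule of $\mathfrak{o}_2^4$; let $P_{\lambda\hookrightarrow 2^4}$ be the stabilizer of this submodule in $G$, and let $U_{\lambda\hookrightarrow 2^4}$ be the kernel of the natural map $P_{\lambda\hookrightarrow 2^4}\to \mathrm{Aut}_{\mathfrak{o}}(M_\lambda)$ given by restriction. Cuspidality. An irreducible representation $\pi$ of $G$ is cuspidal if for every character $\chi:\mathfrak{o}_2^\times\to\mathbb{C}^\times$ the twist $\pi\otimes(\chi\circ\det)$ has no non-zero vector fixed by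 any of the groups $U_{i,j}$ or $U_{\lambda\hookrightarrow 2^4}$ above. *)

theory Defs
  imports
    "HOL-Algebra.Generated_Fields"
    "Jordan_Normal_Form.DL_Rank"
begin

section \<open>Non-archimedean local fields\<close>

text \<open>
  A field that is complete with respect to a normalized discrete valuation
  \<open>val\<close> and has finite residue field. The valuation of \<open>0\<close> is infinite in the
  literature; here \<open>val 0\<close> is an unspecified integer, and no axiom or definition refers to it.
\<close>

class nonarch_local_field = field +
  fixes val :: "'a \<Rightarrow> int"
  assumes val_mult: "x \<noteq> 0 \<Longrightarrow> y \<noteq> 0 \<Longrightarrow> val (x * y) = val x + val y"
    and val_add: "x \<noteq> 0 \<Longrightarrow> y \<noteq> 0 \<Longrightarrow> x + y \<noteq> 0 \<Longrightarrow> min (val x) (val y) \<le> val (x + y)"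
    and val_normalized: "\<exists>x. x \<noteq> 0 \<and> val x = 1"
    and val_residue_finite:
      "\<exists>S. finite S \<and> (\<forall>x. x = 0 \<or> 0 \<le> val x \<longrightarrow> (\<exists>s\<in>S. x - s = 0 \<or> 1 \<le> val (x - s)))"
    and val_complete:
      "(\<forall>k. \<exists>N. \<forall>i\<ge>N. \<forall>j\<ge>N. (s :: nat \<Rightarrow> 'a) i - s j = 0 \<or> k \<le> val (s i - s j)) \<Longrightarrow>
       \<exists>l. \<forall>k. \<exists>N. \<forall>i\<ge>N. s i - l = 0 \<or> k \<le> val (s i - l)"
begin

definition val_ge :: "int \<Rightarrow> 'a \<Rightarrow> bool" where
  "val_ge k x \<longleftrightarrow> x = 0 \<or> k \<le> val x"

lemma val_one [simp]: "val 1 = 0"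
  using val_mult[of 1 1] by simp

lemma val_minus_one: "val (- 1) = 0"
  using val_mult[of "- 1" "- 1"] by simp

lemma val_minus [simp]: "val (- x) = val x"
proof (cases "x = 0")
  case False
  then show ?thesis
    using val_mult[of "- 1" x] val_minus_one by simp
qed simp

lemma val_ge_0 [simp]: "val_ge k 0"
  by (simp add: val_ge_def)

lemma val_ge_add: "val_ge k x \<Longrightarrow> val_ge k y \<Longrightarrow> val_ge k (x + y)"
  unfolding val_ge_def
  by (metis add.left_neutral add.right_neutral min.bounded_iff order_trans val_add)

lemma val_ge_uminus [simp]: "val_ge k (- x) \<longleftrightarrow> val_ge k x"
  by (simp add: val_ge_def)

lemma val_ge_diff: "val_ge k x \<Longrightarrow> val_ge k y \<Longrightarrow> val_ge k (x - y)"
  using val_ge_add[of k x "- y"] by simp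

lemma val_ge_mult: "val_ge k x \<Longrightarrow> val_ge l y \<Longrightarrow> val_ge (k + l) (x * y)"
  unfolding val_ge_def using val_mult by force

end

section \<open>The rings \<open>\<oo>\<close>, \<open>\<oo>\<^sub>2 = \<oo>/\<pp>\<^sup>2\<close> and the residue field \<open>\<oo>/\<pp>\<close>\<close>

typedef (overloaded) 'f integers = "{x :: 'f :: nonarch_local_field. val_ge 0 x}"
  by (rule exI[of _ 0]) simp

setup_lifting type_definition_integers

instantiation integers :: (nonarch_local_field) idom
begin

lift_definition zero_integers :: "'a integers" is 0 by simp
lift_definition one_integers :: "'a integers" is 1 by (simp add: val_ge_def)
lift_definition plus_integers :: "'a integers \<Rightarrow> 'a integers \<Rightarrow> 'a integers" is "(+)"
  by (rule val_ge_add)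
lift_definition minus_integers :: "'a integers \<Rightarrow> 'a integers \<Rightarrow> 'a integers" is "(-)"
  by (rule val_ge_diff)
lift_definition uminus_integers :: "'a integers \<Rightarrow> 'a integers" is uminus
  by simp
lift_definition times_integers :: "'a integers \<Rightarrow> 'a integers \<Rightarrow> 'a integers" is "(*)"
  using val_ge_mult[of 0 _ 0] by simp

instance
proof
  fix a b c :: "'a integers"
  show "a + b + c = a + (b + c)" by transfer (simp add: add.assoc)
  show "a + b = b + a" by transfer (simp add: add.commute)
  show "0 + a = a" by transfer simp
  show "- a + a = 0" by transfer simp
  show "a - b = a + - b" by transfer simp
  show "a * b * c = a * (b * c)" by transfer (simp add: mult.assoc)
  show "a * b = b * a" by transfer (simp add: mult.commute)
  show "1 * a = a" by transfer simp
  show "(a + b) * c = a * c + b * c" by transfer (simp add: distrib_right)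
  show "0 * a = 0" by transfer simp
  show "a * 0 = 0" by transfer simp
  show "a * (b + c) = a * b + a * c" by transfer (simp add: distrib_left)
  show "(0 :: 'a integers) \<noteq> 1" by transfer simp
  show "a \<noteq> 0 \<Longrightarrow> b \<noteq> 0 \<Longrightarrow> a * b \<noteq> 0" by transfer simp
qed

end

lift_definition prime_power :: "nat \<Rightarrow> 'f :: nonarch_local_field integers set" is
  "\<lambda>k. {x. val_ge 0 x \<and> val_ge (int k) x}"
  by auto

lemma prime_power_iff: "x \<in> prime_power k \<longleftrightarrow> val_ge (int k) (Rep_integers x)"
  using Rep_integers[of x] by transfer auto

lemma prime_power_0 [simp]: "0 \<in> prime_power k"
  by (simp add: prime_power_iff zero_integers.rep_eq)

lemma prime_power_add: "x \<in> prime_power k \<Longrightarrow> y \<in> prime_power k \<Longrightarrow> x + y \<in> prime_power k"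
  by (simp add: prime_power_iff plus_integers.rep_eq val_ge_add)

lemma prime_power_uminus [simp]: "- x \<in> prime_power k \<longleftrightarrow> x \<in> prime_power k"
  by (simp add: prime_power_iff uminus_integers.rep_eq)

lemma prime_power_diff: "x \<in> prime_power k \<Longrightarrow> y \<in> prime_power k \<Longrightarrow> x - y \<in> prime_power k"
  by (simp add: prime_power_iff minus_integers.rep_eq val_ge_diff)

lemma prime_power_mult: "x \<in> prime_power k \<Longrightarrow> x * y \<in> prime_power k"
  using val_ge_mult[of "int k" "Rep_integers x" 0 "Rep_integers y"] Rep_integers[of y]
  by (simp add: prime_power_iff times_integers.rep_eq)

lemma prime_power_mono: "x \<in> prime_power k \<Longrightarrow> l \<le> k \<Longrightarrow> x \<in> prime_power l"
  by (auto simp: prime_power_iff val_ge_def)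

definition pcong :: "nat \<Rightarrow> 'f :: nonarch_local_field integers \<Rightarrow> 'f integers \<Rightarrow> bool" where
  "pcong k x y \<longleftrightarrow> x - y \<in> prime_power k"

lemma equivp_pcong: "equivp (pcong k)"
proof (rule equivpI)
  show "reflp (pcong k)" by (simp add: reflp_def pcong_def)
  show "symp (pcong k)"
    unfolding symp_def pcong_def by (metis minus_diff_eq prime_power_uminus)
  show "transp (pcong k)"
  proof (rule transpI)
    fix x y z
    assume "pcong k x y" "pcong k y z"
    then have "(x - y) + (y - z) \<in> prime_power k"
      unfolding pcong_def by (rule prime_power_add)
    then show "pcong k x z" by (simp add: pcong_def)
  qed
qed

lemma pcong_refl [simp]: "pcong k x x"
  by (simp add: pcong_def)

lemma pcong_add: "pcong k x x' \<Longrightarrow> pcong k y y' \<Longrightarrow> pcong k (x + y) (x' + y')"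
  unfolding pcong_def using prime_power_add[of "x - x'" k "y - y'"] by (simp add: algebra_simps)

lemma pcong_diff: "pcong k x x' \<Longrightarrow> pcong k y y' \<Longrightarrow> pcong k (x - y) (x' - y')"
  unfolding pcong_def using prime_power_diff[of "x - x'" k "y - y'"] by (simp add: algebra_simps)

lemma pcong_uminus: "pcong k x x' \<Longrightarrow> pcong k (- x) (- x')"
  unfolding pcong_def using prime_power_uminus[of "x - x'" k] by (simp add: algebra_simps)

lemma pcong_mult: "pcong k x x' \<Longrightarrow> pcong k y y' \<Longrightarrow> pcong k (x * y) (x' * y')"
  unfolding pcong_def
  using prime_power_add[OF prime_power_mult[of "x - x'" k y] prime_power_mult[of "y - y'" k x']]
  by (simp add: algebra_simps)

quotient_type (overloaded) 'f o2 = "'f :: nonarch_local_field integers" / "pcong 2"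
  by (rule equivp_pcong)

instantiation o2 :: (nonarch_local_field) comm_ring_1
begin

lift_definition zero_o2 :: "'a o2" is 0 .
lift_definition one_o2 :: "'a o2" is 1 .
lift_definition plus_o2 :: "'a o2 \<Rightarrow> 'a o2 \<Rightarrow> 'a o2" is "(+)" by (rule pcong_add)
lift_definition minus_o2 :: "'a o2 \<Rightarrow> 'a o2 \<Rightarrow> 'a o2" is "(-)" by (rule pcong_diff)
lift_definition uminus_o2 :: "'a o2 \<Rightarrow> 'a o2" is uminus by (rule pcong_uminus)
lift_definition times_o2 :: "'a o2 \<Rightarrow> 'a o2 \<Rightarrow> 'a o2" is "(*)" by (rule pcong_mult)

instance
proof
  fix a b c :: "'a o2"
  show "a + b + c = a + (b + c)" by transfer (simp add: add.assoc)
  show "a + b = b + a" by transfer (simp add: add.commute)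
  show "0 + a = a" by transfer simp
  show "- a + a = 0" by transfer simp
  show "a - b = a + - b" by transfer simp
  show "a * b * c = a * (b * c)" by transfer (simp add: mult.assoc)
  show "a * b = b * a" by transfer (simp add: mult.commute)
  show "1 * a = a" by transfer simp
  show "(a + b) * c = a * c + b * c" by transfer (simp add: distrib_right)
  show "(0 :: 'a o2) \<noteq> 1"
    by transfer (simp add: pcong_def prime_power_iff one_integers.rep_eq uminus_integers.rep_eq val_ge_def)
qed

end

quotient_type (overloaded) 'f resfield = "'f :: nonarch_local_field integers" / "pcong 1"
  by (rule equivp_pcong)

text \<open>Outside \<open>\<pp>\<close>, \<open>val x = 0\<close> and the inverse of the local field maps \<open>x\<close> into \<open>\<oo>\<close>.\<close>

lemma not_prime_iff: "x \<notin> prime_power 1 \<longleftrightarrow> Rep_integers x \<noteq> 0 \<and> val (Rep_integers x) = 0"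
  using Rep_integers[of x] by (auto simp: prime_power_iff val_ge_def)

lemma val_inverse: "x \<noteq> 0 \<Longrightarrow> val (inverse x) = - val x"
  for x :: "'f :: nonarch_local_field"
  using val_mult[of x "inverse x"] by simp

lift_definition unit_inverse :: "'f :: nonarch_local_field integers \<Rightarrow> 'f integers" is
  "\<lambda>x. if val_ge 1 x then 0 else inverse x"
  by (auto simp: val_ge_def val_inverse)

lemma unit_inverse_mult: "x \<notin> prime_power 1 \<Longrightarrow> unit_inverse x * x = 1"
  unfolding prime_power_iff by transfer (auto simp: val_ge_def)

lemma pcong_unit_inverse:
  assumes "pcong 1 x y" shows "pcong 1 (unit_inverse x) (unit_inverse y)"
proof (cases "x \<in> prime_power 1")
  case True
  then have y: "y \<in> prime_power 1"
    using assms prime_power_diff[of x 1 "x - y"] by (simp add: pcong_def)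
  have "unit_inverse x = 0" "unit_inverse y = 0"
    using True y unfolding prime_power_iff by (transfer; simp)+
  then show ?thesis by (simp add: pcong_def)
next
  case False
  then have y: "y \<notin> prime_power 1"
    using assms prime_power_add[of "x - y" 1 y] by (auto simp: pcong_def)
  have "unit_inverse x - unit_inverse y = (y - x) * (unit_inverse x * unit_inverse y)"
  proof -
    have "unit_inverse x - unit_inverse y =
        (unit_inverse y * y) * unit_inverse x - (unit_inverse x * x) * unit_inverse y"
      by (simp only: unit_inverse_mult[OF False] unit_inverse_mult[OF y] mult_1_left)
    then show ?thesis
      by (simp add: algebra_simps)
  qed
  moreover have "y - x \<in> prime_power 1"
    using assms unfolding pcong_def by (metis minus_diff_eq prime_power_uminus)
  ultimately show ?thesis
    by (simp add: pcong_def prime_power_mult)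
qed

instantiation resfield :: (nonarch_local_field) comm_ring_1
begin

lift_definition zero_resfield :: "'a resfield" is 0 .
lift_definition one_resfield :: "'a resfield" is 1 .
lift_definition plus_resfield :: "'a resfield \<Rightarrow> 'a resfield \<Rightarrow> 'a resfield" is "(+)"
  by (rule pcong_add)
lift_definition minus_resfield :: "'a resfield \<Rightarrow> 'a resfield \<Rightarrow> 'a resfield" is "(-)"
  by (rule pcong_diff)
lift_definition uminus_resfield :: "'a resfield \<Rightarrow> 'a resfield" is uminus
  by (rule pcong_uminus)
lift_definition times_resfield :: "'a resfield \<Rightarrow> 'a resfield \<Rightarrow> 'a resfield" is "(*)"
  by (rule pcong_mult)

instance
proof
  fix a b c :: "'a resfield"
  show "a + b + c = a + (b + c)" by transfer (simp add: add.assoc)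
  show "a + b = b + a" by transfer (simp add: add.commute)
  show "0 + a = a" by transfer simp
  show "- a + a = 0" by transfer simp
  show "a - b = a + - b" by transfer simp
  show "a * b * c = a * (b * c)" by transfer (simp add: mult.assoc)
  show "a * b = b * a" by transfer (simp add: mult.commute)
  show "1 * a = a" by transfer simp
  show "(a + b) * c = a * c + b * c" by transfer (simp add: distrib_right)
  show "(0 :: 'a resfield) \<noteq> 1"
    by transfer (simp add: pcong_def prime_power_iff one_integers.rep_eq uminus_integers.rep_eq val_ge_def)
qed

end

instantiation resfield :: (nonarch_local_field) field
begin

lift_definition inverse_resfield :: "'a resfield \<Rightarrow> 'a resfield" is unit_inverse
  by (rule pcong_unit_inverse)
definition divide_resfield :: "'a resfield \<Rightarrow> 'a resfield \<Rightarrow> 'a resfield" where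
  "divide_resfield x y = x * inverse y"

instance
proof
  fix a b :: "'a resfield"
  show "a div b = a * inverse b" by (simp add: divide_resfield_def)
  show "inverse (0 :: 'a resfield) = 0"
    by transfer (simp add: pcong_def prime_power_iff unit_inverse.rep_eq zero_integers.rep_eq)
  show "a \<noteq> 0 \<Longrightarrow> inverse a * a = 1"
    by transfer (simp add: pcong_def unit_inverse_mult)
qed

end

instance resfield :: (nonarch_local_field) finite
proof
  have "\<exists>S :: 'a set. finite S \<and> (\<forall>x. val_ge 0 x \<longrightarrow> (\<exists>s\<in>S. val_ge 1 (x - s)))"
    unfolding val_ge_def by (rule val_residue_finite)
  then obtain S :: "'a set" where S: "finite S"
    "\<forall>x. val_ge 0 x \<longrightarrow> (\<exists>s\<in>S. val_ge 1 (x - s))"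
    by (elim exE conjE)
  define f where "f x = (SOME s. s \<in> S \<and> val_ge 1 (x - s))" for x
  have f: "f x \<in> S \<and> val_ge 1 (x - f x)" if "val_ge 0 x" for x
  proof -
    have "\<exists>s. s \<in> S \<and> val_ge 1 (x - s)" using S(2) that by blast
    then show ?thesis unfolding f_def by (rule someI_ex)
  qed
  let ?r = "\<lambda>a :: 'a resfield. Rep_integers (rep_resfield a)"
  have r: "val_ge 0 (?r a)" for a
    using Rep_integers[of "rep_resfield a"] by simp
  have "inj (\<lambda>a. f (?r a))"
  proof (rule injI)
    fix a b :: "'a resfield"
    assume eq: "f (?r a) = f (?r b)"
    have "val_ge 1 ((?r a - f (?r a)) - (?r b - f (?r b)))"
      by (intro val_ge_diff conjunct2[OF f] r)
    also have "(?r a - f (?r a)) - (?r b - f (?r b)) = ?r a - ?r b"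
      unfolding eq by simp
    finally have "pcong 1 (rep_resfield a) (rep_resfield b)"
      by (simp add: pcong_def prime_power_iff minus_integers.rep_eq)
    then show "a = b"
      by (simp only: Quotient_rel_rep[OF Quotient_resfield])
  qed
  moreover have "range (\<lambda>a. f (?r a)) \<subseteq> S"
  proof
    fix s assume "s \<in> range (\<lambda>a. f (?r a))"
    then obtain a where "s = f (?r a)" ..
    then show "s \<in> S" using f[OF r] by simp
  qed
  ultimately show "finite (UNIV :: 'a resfield set)"
    using S(1) by (rule inj_on_finite)
qed

definition to_resfield :: "'f :: nonarch_local_field o2 \<Rightarrow> 'f resfield" where
  "to_resfield x = abs_resfield (rep_o2 x)"

definition lift_o2 :: "'f :: nonarch_local_field resfield \<Rightarrow> 'f o2" where
  "lift_o2 x = abs_o2 (rep_resfield x)"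

lemma to_resfield_abs_o2 [simp]: "to_resfield (abs_o2 x) = abs_resfield x"
proof -
  have "pcong 2 (rep_o2 (abs_o2 x)) x"
    by (rule Quotient_rep_abs[OF Quotient_o2 equivp_reflp[OF equivp_pcong]])
  then show ?thesis
    unfolding to_resfield_def resfield.abs_eq_iff pcong_def by (rule prime_power_mono) simp
qed

lemma to_resfield_lift_o2 [simp]: "to_resfield (lift_o2 x) = x"
  by (simp add: lift_o2_def Quotient_abs_rep[OF Quotient_resfield])

text \<open>Additive characters of \<open>\<oo>\<close> with conductor \<open>\<pp>\<^sup>2\<close>.\<close>

definition additive_character :: "('f :: nonarch_local_field integers \<Rightarrow> complex) \<Rightarrow> bool" where
  "additive_character \<psi> \<longleftrightarrow>
     (\<forall>x. \<psi> x \<noteq> 0) \<and> (\<forall>x y. \<psi> (x + y) = \<psi> x * \<psi> y) \<and>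
     (\<forall>x\<in>prime_power 2. \<psi> x = 1) \<and> (\<exists>x\<in>prime_power 1. \<psi> x \<noteq> 1)"

section \<open>Finite-dimensional complex representations\<close>

definition GL :: "nat \<Rightarrow> 'a :: comm_ring_1 mat monoid" where
  "GL n = units_of (ring_mat TYPE('a) n ())"

definition is_representation :: "('g, 'x) monoid_scheme \<Rightarrow> nat \<Rightarrow> ('g \<Rightarrow> complex mat) \<Rightarrow> bool" where
  "is_representation G n \<pi> \<longleftrightarrow> \<pi> \<in> hom G (GL n)"

definition irreducible_representation ::
    "('g, 'x) monoid_scheme \<Rightarrow> nat \<Rightarrow> ('g \<Rightarrow> complex mat) \<Rightarrow> bool" where
  "irreducible_representation G n \<pi> \<longleftrightarrow> is_representation G n \<pi> \<and> 0 < n \<and>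
     (\<forall>W. subspace class_ring W (module_vec TYPE(complex) n) \<and>
          (\<forall>g\<in>carrier G. \<forall>w\<in>W. \<pi> g *\<^sub>v w \<in> W) \<longrightarrow>
          W = {0\<^sub>v n} \<or> W = carrier_vec n)"

definition has_fixed_vector :: "nat \<Rightarrow> ('g \<Rightarrow> complex mat) \<Rightarrow> 'g set \<Rightarrow> bool" where
  "has_fixed_vector n \<pi> U \<longleftrightarrow> (\<exists>v\<in>carrier_vec n. v \<noteq> 0\<^sub>v n \<and> (\<forall>u\<in>U. \<pi> u *\<^sub>v v = v))"

definition kronecker :: "'a :: semiring_1 mat \<Rightarrow> 'a mat \<Rightarrow> 'a mat" where
  "kronecker A B = mat (dim_row A * dim_row B) (dim_col A * dim_col B)
     (\<lambda>(i, j). A $$ (i div dim_row B, j div dim_col B) * B $$ (i mod dim_row B, j mod dim_col B))"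

definition tensor_rep ::
    "('g \<Rightarrow> complex mat) \<Rightarrow> ('g \<Rightarrow> complex mat) \<Rightarrow> 'g \<Rightarrow> complex mat" where
  "tensor_rep \<pi> \<sigma> g = kronecker (\<pi> g) (\<sigma> g)"

definition character_rep :: "('g \<Rightarrow> complex) \<Rightarrow> 'g \<Rightarrow> complex mat" where
  "character_rep \<chi> g = mat 1 1 (\<lambda>_. \<chi> g)"

definition pulled_back ::
    "('g, 'x) monoid_scheme \<Rightarrow> 'g set \<Rightarrow> nat \<Rightarrow> ('g \<Rightarrow> complex mat) \<Rightarrow> bool" where
  "pulled_back G N n \<theta> \<longleftrightarrow>
     (\<exists>\<sigma>. is_representation (G Mod N) n \<sigma> \<and> (\<forall>g\<in>carrier G. \<theta> g = \<sigma> (N #>\<^bsub>G\<^esub> g)))"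

text \<open>
  The space of the representation induced from \<open>(\<rho>, \<complex>\<^sup>d)\<close> on a subgroup \<open>H\<close>; the group
  \<open>G\<close> acts on it by right translation, \<open>(x \<cdot> f) g = f (g x)\<close>.
\<close>

definition induced_space ::
    "('g, 'x) monoid_scheme \<Rightarrow> 'g set \<Rightarrow> nat \<Rightarrow> ('g \<Rightarrow> complex mat) \<Rightarrow> ('g \<Rightarrow> complex vec) set" where
  "induced_space G H d \<rho> =
     {f \<in> carrier G \<rightarrow>\<^sub>E carrier_vec d. \<forall>h\<in>H. \<forall>g\<in>carrier G. f (h \<otimes>\<^bsub>G\<^esub> g) = \<rho> h *\<^sub>v f g}"

definition isomorphic_to_induced ::
    "('g, 'x) monoid_scheme \<Rightarrow> nat \<Rightarrow> ('g \<Rightarrow> complex mat) \<Rightarrow>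
     'g set \<Rightarrow> nat \<Rightarrow> ('g \<Rightarrow> complex mat) \<Rightarrow> bool" where
  "isomorphic_to_induced G n \<pi> H d \<rho> \<longleftrightarrow>
     (\<exists>T. bij_betw T (carrier_vec n) (induced_space G H d \<rho>) \<and>
       (\<forall>v\<in>carrier_vec n. \<forall>w\<in>carrier_vec n. \<forall>g\<in>carrier G. T (v + w) g = T v g + T w g) \<and>
       (\<forall>c. \<forall>v\<in>carrier_vec n. \<forall>g\<in>carrier G. T (c \<cdot>\<^sub>v v) g = c \<cdot>\<^sub>v T v g) \<and>
       (\<forall>x\<in>carrier G. \<forall>v\<in>carrier_vec n. \<forall>g\<in>carrier G. T (\<pi> x *\<^sub>v v) g = T v (g \<otimes>\<^bsub>G\<^esub> x)))"

section \<open>The group \<open>GL\<^sub>4(\<oo>\<^sub>2)\<close>, orbits and stabilizers\<close>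

abbreviation G4 :: "'f :: nonarch_local_field o2 mat monoid" where
  "G4 \<equiv> GL 4"

definition K1 :: "'f :: nonarch_local_field o2 mat set" where
  "K1 = {g \<in> carrier G4. map_mat to_resfield g = 1\<^sub>m 4}"

definition mat_trace :: "'a :: comm_monoid_add mat \<Rightarrow> 'a" where
  "mat_trace A = (\<Sum>i<dim_row A. A $$ (i, i))"

text \<open>
  The entrywise lift of \<open>\<beta>\<close> along \<open>lift_o2\<close> and the representative of the trace in \<open>\<oo>\<close> are
  immaterial for \<open>x \<in> K1\<close>, see \<open>psi_char_eq\<close> below.
\<close>

definition psi_char ::
    "('f :: nonarch_local_field integers \<Rightarrow> complex) \<Rightarrow> 'f resfield mat \<Rightarrow> 'f o2 mat \<Rightarrow> complex" where
  "psi_char \<psi> \<beta> x = \<psi> (rep_o2 (mat_trace (map_mat lift_o2 \<beta> * (x - 1\<^sub>m 4))))"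

lemma o2_mult_eq_0:
  assumes "to_resfield c = 0" "to_resfield d = 0"
  shows "c * d = 0"
proof -
  obtain x y where xy: "c = abs_o2 x" "d = abs_o2 y"
    by (metis Quotient_abs_rep[OF Quotient_o2])
  have p: "x \<in> prime_power 1" "y \<in> prime_power 1"
    using assms by (simp_all add: xy zero_resfield_def resfield.abs_eq_iff pcong_def)
  have "x * y \<in> prime_power 2"
    using val_ge_mult[of 1 "Rep_integers x" 1 "Rep_integers y"] p
    by (simp add: prime_power_iff times_integers.rep_eq)
  then show ?thesis
    by (simp add: xy times_o2.abs_eq zero_o2_def o2.abs_eq_iff pcong_def)
qed

lemma to_resfield_diff: "to_resfield (c - d) = to_resfield c - to_resfield d"
proof -
  obtain x y where xy: "c = abs_o2 x" "d = abs_o2 y"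
    by (metis Quotient_abs_rep[OF Quotient_o2])
  show ?thesis by (simp add: xy minus_o2.abs_eq minus_resfield.abs_eq)
qed

lemma to_resfield_0 [simp]: "to_resfield 0 = 0"
  by (simp add: zero_o2_def zero_resfield_def)

lemma to_resfield_1 [simp]: "to_resfield 1 = 1"
  by (simp add: one_o2_def one_resfield_def)

lemma additive_character_pcong:
  assumes "additive_character \<psi>" "pcong 2 a b"
  shows "\<psi> a = \<psi> b"
proof -
  have "\<psi> ((a - b) + b) = \<psi> (a - b) * \<psi> b" "\<psi> (a - b) = 1"
    using assms unfolding additive_character_def pcong_def by blast+
  then show ?thesis by simp
qed

lemma psi_char_eq:
  assumes \<psi>: "additive_character \<psi>" and x: "x \<in> K1"
    and B: "B \<in> carrier_mat 4 4" "map_mat to_resfield B = \<beta>"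
    and a: "abs_o2 a = mat_trace (B * (x - 1\<^sub>m 4))"
  shows "psi_char \<psi> \<beta> x = \<psi> a"
proof -
  let ?L = "map_mat lift_o2 \<beta>" and ?X = "x - 1\<^sub>m 4"
  have xc: "x \<in> carrier_mat 4 4" and xr: "map_mat to_resfield x = 1\<^sub>m 4"
    using x by (auto simp: K1_def GL_def units_of_def Units_def ring_mat_simps)
  have \<beta>: "\<beta> \<in> carrier_mat 4 4" using B by auto
  have X0: "to_resfield (?X $$ (k, i)) = 0" if "k < 4" "i < 4" for k i
  proof -
    have "to_resfield (x $$ (k, i)) = (1\<^sub>m 4 :: 'a resfield mat) $$ (k, i)"
      using xc that by (simp flip: xr)
    then show ?thesis using xc that by (simp add: to_resfield_diff)
  qed
  have eq: "?L $$ (i, k) * ?X $$ (k, i) = B $$ (i, k) * ?X $$ (k, i)" if "i < 4" "k < 4" for i k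
  proof -
    have "to_resfield (?L $$ (i, k) - B $$ (i, k)) = 0"
      using B \<beta> that by (auto simp: to_resfield_diff)
    then have "(?L $$ (i, k) - B $$ (i, k)) * ?X $$ (k, i) = 0"
      using o2_mult_eq_0 X0 that by blast
    then show ?thesis by (simp add: left_diff_distrib)
  qed
  have tr: "mat_trace (C * ?X) = (\<Sum>i<4. \<Sum>k<4. C $$ (i, k) * ?X $$ (k, i))"
    if "C \<in> carrier_mat 4 4" for C
    using that xc by (auto simp: mat_trace_def scalar_prod_def atLeast0LessThan intro!: sum.cong)
  have "mat_trace (?L * ?X) = mat_trace (B * ?X)"
    using tr[of ?L] tr[OF B(1)] \<beta> eq by simp
  then have "abs_o2 (rep_o2 (mat_trace (?L * ?X))) = abs_o2 a"
    by (simp add: a Quotient_abs_rep[OF Quotient_o2])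
  then show ?thesis
    unfolding psi_char_def o2.abs_eq_iff by (rule additive_character_pcong[OF \<psi>])
qed

definition orbit ::
    "('f :: nonarch_local_field integers \<Rightarrow> complex) \<Rightarrow> nat \<Rightarrow> ('f o2 mat \<Rightarrow> complex mat) \<Rightarrow>
     'f resfield mat set" where
  "orbit \<psi> n \<pi> = {\<beta> \<in> carrier_mat 4 4.
     \<exists>v\<in>carrier_vec n. v \<noteq> 0\<^sub>v n \<and> (\<forall>x\<in>K1. \<pi> x *\<^sub>v v = psi_char \<psi> \<beta> x \<cdot>\<^sub>v v)}"

definition stabilizer ::
    "('f :: nonarch_local_field integers \<Rightarrow> complex) \<Rightarrow> 'f resfield mat \<Rightarrow> 'f o2 mat set" where
  "stabilizer \<psi> \<beta> = {g \<in> carrier G4.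
     \<forall>x\<in>K1. psi_char \<psi> \<beta> (inv\<^bsub>G4\<^esub> g \<otimes>\<^bsub>G4\<^esub> x \<otimes>\<^bsub>G4\<^esub> g) = psi_char \<psi> \<beta> x}"

section \<open>The matrix \<open>\<beta>\<^sub>2\<close>\<close>

text \<open>
  \<open>\<iota>\<close> is the inclusion of the base field \<open>'k\<close> into the quadratic extension \<open>'l\<close>. The \<open>j\<close>-th
  column of \<open>mult_matrix \<iota> \<eta> x\<close> contains the coordinates of \<open>x * b j\<close> in the basis
  \<open>b = (1, \<eta>)\<close>.
\<close>

definition mult_matrix :: "('k :: field \<Rightarrow> 'l :: field) \<Rightarrow> 'l \<Rightarrow> 'l \<Rightarrow> 'k mat" where
  "mult_matrix \<iota> \<eta> x = (THE A. A \<in> carrier_mat 2 2 \<and>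
     (\<forall>j<2. x * [1, \<eta>] ! j = (\<Sum>i<2. \<iota> (A $$ (i, j)) * [1, \<eta>] ! i)))"

definition block_embed :: "('k :: field \<Rightarrow> 'l :: field) \<Rightarrow> 'l \<Rightarrow> 'l mat \<Rightarrow> 'k mat" where
  "block_embed \<iota> \<eta> B = mat (2 * dim_row B) (2 * dim_col B)
     (\<lambda>(i, j). mult_matrix \<iota> \<eta> (B $$ (i div 2, j div 2)) $$ (i mod 2, j mod 2))"

definition beta2 :: "('k :: field \<Rightarrow> 'l :: field) \<Rightarrow> 'l \<Rightarrow> 'k mat" where
  "beta2 \<iota> \<eta> = block_embed \<iota> \<eta> (mat_of_rows_list 2 [[\<eta>, 0], [0, \<eta>]])"

section \<open>Cuspidality\<close>

definition U_geom :: "nat \<Rightarrow> nat \<Rightarrow> 'f :: nonarch_local_field o2 mat set" where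
  "U_geom i j = {four_block_mat (1\<^sub>m i) X (0\<^sub>m j i) (1\<^sub>m j) | X. X \<in> carrier_mat i j}"

text \<open>
  A partition \<open>\<mu>\<close> with four parts, each \<open>1\<close> or \<open>2\<close>, is a list, and
  \<open>\<oo>/\<pp>\<^bsup>\<mu>\<^sub>i\<^esup>\<close> is embedded into \<open>\<oo>\<^sub>2\<close> as \<open>\<pp>\<^bsup>2 - \<mu>\<^sub>i\<^esup>/\<pp>\<^sup>2\<close>.
\<close>

definition M_inf :: "nat list \<Rightarrow> 'f :: nonarch_local_field o2 vec set" where
  "M_inf \<mu> = {v \<in> carrier_vec 4. \<forall>i<4. v $ i \<in> abs_o2 ` prime_power (2 - \<mu> ! i)}"

definition P_inf :: "nat list \<Rightarrow> 'f :: nonarch_local_field o2 mat set" where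
  "P_inf \<mu> = {g \<in> carrier G4. (*\<^sub>v) g ` M_inf \<mu> = M_inf \<mu>}"

definition U_inf :: "nat list \<Rightarrow> 'f :: nonarch_local_field o2 mat set" where
  "U_inf \<mu> = {g \<in> P_inf \<mu>. \<forall>v\<in>M_inf \<mu>. g *\<^sub>v v = v}"

definition cuspidal :: "nat \<Rightarrow> ('f :: nonarch_local_field o2 mat \<Rightarrow> complex mat) \<Rightarrow> bool" where
  "cuspidal n \<pi> \<longleftrightarrow>
     (\<forall>\<chi> \<in> hom (units_of (class_ring :: 'f o2 ring)) (units_of (class_ring :: complex ring)).
        let \<pi>' = tensor_rep \<pi> (character_rep (\<lambda>g. \<chi> (det g))) in
        (\<forall>(i, j) \<in> {(1, 3), (2, 2), (3, 1)}. \<not> has_fixed_vector n \<pi>' (U_geom i j)) \<and>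
        (\<forall>\<mu> \<in> {[2, 1, 1, 1], [2, 2, 1, 1], [2, 2, 2, 1]}. \<not> has_fixed_vector n \<pi>' (U_inf \<mu>)))"

end

theory Submission
  imports Defs
begin

text \<open>
  The representation \<open>\<pi>\<close> acts by right translation on functions \<open>f\<close> on \<open>G\<close> with
  \<open>f (h g) = \<rho>(h) f(g)\<close> for \<open>h \<in> H = G(\<psi>\<^sub>\<beta>)\<close>, so a vector fixed by a subgroup \<open>U\<close> is a right
  \<open>U\<close>-invariant function. If such a function does not vanish at \<open>g\<close>, then its value there is fixed
  by \<open>\<rho>(H \<inter> g U g\<inverse>)\<close>; this is the part of Mackey theory that the argument rests on.

  On \<open>K\<^sub>1\<close> the representation \<open>\<rho>\<close> is the scalar \<open>\<psi>\<^sub>\<beta>\<close>. Hence \<open>\<psi>\<^sub>\<beta>\<close> is trivial on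
  \<open>g (U \<inter> K\<^sub>1) g\<inverse>\<close>, and as the trace is cyclic this is a condition on the conjugate
  \<open>B = g\<inverse> \<beta> g\<close>: whenever \<open>U\<close> contains all \<open>1 + c E\<^bsub>i j\<^esub>\<close> with \<open>c \<in> \<pp>/\<pp>\<^sup>2\<close>, the entry of \<open>B\<close> at
  \<open>(j, i)\<close> vanishes (\<open>invariance_kills_entry\<close>). On the other hand \<open>B\<close> satisfies the quadratic equation
  \<open>B\<^sup>2 = c\<^sub>1 B + c\<^sub>0\<close> of \<open>\<eta>\<close>, which has no root in \<open>\<F>\<^sub>q\<close>. Thus \<open>B\<close> has no eigenvector over \<open>\<F>\<^sub>q\<close>, and no
  row or column of \<open>B\<close> can vanish off the diagonal (\<open>row_not_diagonal\<close>, \<open>column_not_diagonal\<close>).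

  This excludes fixed vectors for all groups but \<open>U\<^bsub>2,2\<^esub>\<close>. Each infinitesimal group, and also
  \<open>U\<^bsub>3,1\<^esub>\<close>, contains the elements \<open>1 + c E\<^bsub>i 4\<^esub>\<close> for \<open>i < 4\<close> and \<open>c \<in> \<pp>/\<pp>\<^sup>2\<close>, so a fixed vector would
  force the last row of \<open>B\<close> to vanish off the diagonal; \<open>U\<^bsub>1,3\<^esub>\<close> would force this on the first column.
  All these elements have determinant \<open>1\<close>, and so do those of \<open>U\<^bsub>2,2\<^esub>\<close>, so twisting by \<open>\<chi> \<circ> det\<close> changes
  nothing.

  For \<open>U = U\<^bsub>2,2\<^esub>\<close> the condition is that \<open>B\<close> is block upper triangular, in other words that \<open>g\<close> moves the
  first coordinate plane to a \<open>\<beta>\<close>-stable plane. Such a plane is a line over \<open>\<F>\<^bsub>q\<^sup>2\<^esub>\<close>, and \<open>GL\<^sub>2(\<F>\<^bsub>q\<^sup>2\<^esub>)\<close>, the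
  centralizer of \<open>\<beta>\<close>, permutes these lines transitively. Therefore \<open>g\<close> is a product of an element of \<open>H\<close>
  and a block upper triangular matrix (\<open>parabolic_transversal\<close>). The latter normalizes \<open>U\<close>, so the
  value of \<open>f\<close> there is a nonzero vector fixed by \<open>\<rho>(H \<inter> U)\<close>. Conversely, a vector fixed by \<open>\<rho>(H \<inter> U)\<close>
  is the value at \<open>1\<close> of a \<open>U\<close>-invariant function supported on \<open>H U\<close> (\<open>induced_invariant_function\<close>).
\<close>

section \<open>Invariant vectors of induced representations\<close>

lemma group_GL: "group (GL n :: 'a :: comm_ring_1 mat monoid)"
proof -
  interpret ring "ring_mat TYPE('a) n ()" by (rule ring_mat)
  show ?thesis unfolding GL_def by (rule units_group)
qed

lemma mult_GL: "x \<otimes>\<^bsub>GL n\<^esub> y = x * y"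
  by (simp add: GL_def units_of_def ring_mat_simps)

lemma one_GL: "\<one>\<^bsub>GL n\<^esub> = 1\<^sub>m n"
  by (simp add: GL_def units_of_def ring_mat_simps)

lemma GL_carrier_mat: "x \<in> carrier (GL n) \<Longrightarrow> x \<in> carrier_mat n n"
  by (simp add: GL_def units_of_def Units_def ring_mat_simps)

lemma GL_memI:
  assumes "x \<in> carrier_mat n n" "y \<in> carrier_mat n n" "x * y = 1\<^sub>m n" "y * x = 1\<^sub>m n"
  shows "x \<in> carrier (GL n)"
  using assms by (auto simp: GL_def units_of_def Units_def ring_mat_simps)

lemma GL_memI_det:
  fixes x :: "'a :: comm_ring_1 mat"
  assumes x: "x \<in> carrier_mat n n" and d: "det x * d = 1"
  shows "x \<in> carrier (GL n)"
proof (rule GL_memI[OF x])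
  note a = adj_mat[OF x]
  have e: "det x * d = 1" "d * det x = 1" using d by (auto simp: mult.commute)
  show "d \<cdot>\<^sub>m adj_mat x \<in> carrier_mat n n" using a by auto
  have one: "d \<cdot>\<^sub>m (det x \<cdot>\<^sub>m 1\<^sub>m n) = 1\<^sub>m n"
    using e by (intro eq_matI) (auto simp flip: mult.assoc)
  show "x * (d \<cdot>\<^sub>m adj_mat x) = 1\<^sub>m n"
    unfolding mult_smult_distrib[OF x a(1)] a(2) by (rule one)
  show "(d \<cdot>\<^sub>m adj_mat x) * x = 1\<^sub>m n"
    unfolding mult_smult_assoc_mat[OF a(1) x] a(3) by (rule one)
qed

lemma is_representation_carrier:
  "is_representation G n \<pi> \<Longrightarrow> g \<in> carrier G \<Longrightarrow> \<pi> g \<in> carrier_mat n n"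
  unfolding is_representation_def hom_def using GL_carrier_mat by blast

lemma is_representation_mult:
  "is_representation G n \<pi> \<Longrightarrow> g \<in> carrier G \<Longrightarrow> h \<in> carrier G \<Longrightarrow> \<pi> (g \<otimes>\<^bsub>G\<^esub> h) = \<pi> g * \<pi> h"
  unfolding is_representation_def hom_def by (simp add: mult_GL)

lemma is_representation_one:
  "is_representation G n \<pi> \<Longrightarrow> group G \<Longrightarrow> \<pi> \<one>\<^bsub>G\<^esub> = 1\<^sub>m n"
  unfolding is_representation_def using hom_one[of \<pi> G "GL n", OF _ _ group_GL] by (simp add: one_GL)

lemma has_fixed_vector_iff_induced:
  assumes iso: "isomorphic_to_induced G n \<pi> H d \<rho>" and \<pi>: "is_representation G n \<pi>"
    and U: "U \<subseteq> carrier G"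
  shows "has_fixed_vector n \<pi> U \<longleftrightarrow>
    (\<exists>f\<in>induced_space G H d \<rho>. (\<exists>g\<in>carrier G. f g \<noteq> 0\<^sub>v d) \<and>
      (\<forall>u\<in>U. \<forall>g\<in>carrier G. f (g \<otimes>\<^bsub>G\<^esub> u) = f g))"
proof -
  from iso obtain T where bij: "bij_betw T (carrier_vec n) (induced_space G H d \<rho>)"
    and scal: "\<And>c v g. v \<in> carrier_vec n \<Longrightarrow> g \<in> carrier G \<Longrightarrow> T (c \<cdot>\<^sub>v v) g = c \<cdot>\<^sub>v T v g"
    and equiv: "\<And>x v g. x \<in> carrier G \<Longrightarrow> v \<in> carrier_vec n \<Longrightarrow> g \<in> carrier G \<Longrightarrow>
        T (\<pi> x *\<^sub>v v) g = T v (g \<otimes>\<^bsub>G\<^esub> x)"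
    unfolding isomorphic_to_induced_def by blast
  have funT: "T v \<in> carrier G \<rightarrow>\<^sub>E carrier_vec d" if "v \<in> carrier_vec n" for v
    using bij_betwE[OF bij] that unfolding induced_space_def by blast
  have zero: "T (0\<^sub>v n) g = 0\<^sub>v d" if g: "g \<in> carrier G" for g
  proof -
    have c: "T (0\<^sub>v n) g \<in> carrier_vec d" using PiE_mem[OF funT g] by simp
    have "0 \<cdot>\<^sub>v 0\<^sub>v n = (0\<^sub>v n :: complex vec)" by (rule eq_vecI) auto
    then have "T (0\<^sub>v n) g = 0 \<cdot>\<^sub>v T (0\<^sub>v n) g"
      using scal[of "0\<^sub>v n" g 0] g by simp
    also have "\<dots> = 0\<^sub>v d" using c by (intro eq_vecI) auto
    finally show ?thesis .
  qed
  have ext: "v = w" if "v \<in> carrier_vec n" "w \<in> carrier_vec n"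
    "\<And>g. g \<in> carrier G \<Longrightarrow> T v g = T w g" for v w
  proof -
    have "T v = T w" using PiE_ext[OF funT[OF that(1)] funT[OF that(2)] that(3)] .
    then show ?thesis using inj_onD[OF bij_betw_imp_inj_on[OF bij]] that by blast
  qed
  show ?thesis
  proof
    assume "has_fixed_vector n \<pi> U"
    then obtain v where v: "v \<in> carrier_vec n" "v \<noteq> 0\<^sub>v n" "\<And>u. u \<in> U \<Longrightarrow> \<pi> u *\<^sub>v v = v"
      unfolding has_fixed_vector_def by blast
    have "\<exists>g\<in>carrier G. T v g \<noteq> 0\<^sub>v d"
      using ext[of v "0\<^sub>v n"] v(1,2) zero by auto
    moreover have "T v (g \<otimes>\<^bsub>G\<^esub> u) = T v g" if "u \<in> U" "g \<in> carrier G" for u g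
      using equiv[of u v g] v U that by auto
    ultimately show "\<exists>f\<in>induced_space G H d \<rho>. (\<exists>g\<in>carrier G. f g \<noteq> 0\<^sub>v d) \<and>
      (\<forall>u\<in>U. \<forall>g\<in>carrier G. f (g \<otimes>\<^bsub>G\<^esub> u) = f g)"
      using bspec[OF bij_betwE[OF bij] v(1)] by (intro bexI[of _ "T v"]) auto
  next
    assume "\<exists>f\<in>induced_space G H d \<rho>. (\<exists>g\<in>carrier G. f g \<noteq> 0\<^sub>v d) \<and>
      (\<forall>u\<in>U. \<forall>g\<in>carrier G. f (g \<otimes>\<^bsub>G\<^esub> u) = f g)"
    then obtain f where f: "f \<in> induced_space G H d \<rho>" "\<exists>g\<in>carrier G. f g \<noteq> 0\<^sub>v d"
      "\<And>u g. u \<in> U \<Longrightarrow> g \<in> carrier G \<Longrightarrow> f (g \<otimes>\<^bsub>G\<^esub> u) = f g"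
      by blast
    obtain v where v: "v \<in> carrier_vec n" "T v = f"
      using f(1) bij_betw_imp_surj_on[OF bij] by (metis imageE)
    have "v \<noteq> 0\<^sub>v n" using zero f(2) v(2) by auto
    moreover have "\<pi> u *\<^sub>v v = v" if u: "u \<in> U" for u
    proof (rule ext)
      have uG: "u \<in> carrier G" using U u by blast
      show "\<pi> u *\<^sub>v v \<in> carrier_vec n"
        using is_representation_carrier[OF \<pi> uG] v(1) by auto
      show "T (\<pi> u *\<^sub>v v) g = T v g" if "g \<in> carrier G" for g
        using equiv[OF uG v(1) that] f(3)[OF u that] v(2) by simp
    qed (rule v(1))
    ultimately show "has_fixed_vector n \<pi> U"
      unfolding has_fixed_vector_def using v(1) by (intro bexI[of _ v]) auto
  qed
qed

text \<open>
  The function is \<open>h u \<mapsto> \<rho>(h) v\<close> on \<open>H U\<close> and zero elsewhere. It is well defined because two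
  factorizations of the same element differ by an element of \<open>H \<inter> U\<close>, which fixes \<open>v\<close>.
\<close>

lemma (in group) induced_invariant_function:
  assumes H: "subgroup H G" and U: "subgroup U G"
    and \<rho>: "is_representation (G\<lparr>carrier := H\<rparr>) d \<rho>"
    and fixed: "has_fixed_vector d \<rho> (H \<inter> U)"
  shows "\<exists>f\<in>induced_space G H d \<rho>. (\<exists>g\<in>carrier G. f g \<noteq> 0\<^sub>v d) \<and>
      (\<forall>u\<in>U. \<forall>g\<in>carrier G. f (g \<otimes> u) = f g)"
proof -
  interpret H: subgroup H G by (rule H)
  interpret U: subgroup U G by (rule U)
  obtain v where v: "v \<in> carrier_vec d" "v \<noteq> 0\<^sub>v d"
    and vfix: "\<And>u. u \<in> H \<Longrightarrow> u \<in> U \<Longrightarrow> \<rho> u *\<^sub>v v = v"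
    using fixed unfolding has_fixed_vector_def by blast
  have \<rho>c: "\<rho> h \<in> carrier_mat d d" if "h \<in> H" for h
    using is_representation_carrier[OF \<rho>] that by simp
  have \<rho>m: "\<rho> (h \<otimes> k) = \<rho> h * \<rho> k" if "h \<in> H" "k \<in> H" for h k
    using is_representation_mult[OF \<rho>] that by simp
  have "group (G\<lparr>carrier := H\<rparr>)" by (rule subgroup_imp_group[OF H])
  then have \<rho>1: "\<rho> \<one> = 1\<^sub>m d"
    using is_representation_one[OF \<rho>] by simp
  have cancel: "x \<otimes> (inv x \<otimes> y) = y" "inv x \<otimes> (x \<otimes> y) = y"
    if "x \<in> carrier G" "y \<in> carrier G" for x y
    using that by (simp_all flip: m_assoc)
  \<comment> \<open>\<open>D g h\<close> means that \<open>h\<close> is the first factor of \<open>g\<close> in some factorization in \<open>H U\<close>.\<close>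
  define D where "D g h \<longleftrightarrow> h \<in> H \<and> inv h \<otimes> g \<in> U" for g h
  define f where "f = (\<lambda>g\<in>carrier G. if \<exists>h. D g h then \<rho> (SOME h. D g h) *\<^sub>v v else 0\<^sub>v d)"
  have well: "\<rho> h *\<^sub>v v = \<rho> k *\<^sub>v v" if "g \<in> carrier G" "D g h" "D g k" for g h k
  proof -
    have hk: "h \<in> H" "k \<in> H" "inv h \<otimes> g \<in> U" "inv k \<otimes> g \<in> U"
      using that by (auto simp: D_def)
    let ?w = "inv k \<otimes> h"
    have "?w = (inv k \<otimes> g) \<otimes> inv (inv h \<otimes> g)"
      using hk(1,2) that(1) by (simp add: inv_mult_group m_assoc cancel)
    then have "?w \<in> U" using hk(3,4) by simp
    moreover have "?w \<in> H" using hk(1,2) by simp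
    ultimately have w: "?w \<in> H" "?w \<in> U" by auto
    have "h = k \<otimes> ?w" using hk(1,2) by (simp add: cancel)
    then have "\<rho> h = \<rho> k * \<rho> ?w" using \<rho>m[OF hk(2) w(1)] by simp
    then show ?thesis
      using assoc_mult_mat_vec[OF \<rho>c[OF hk(2)] \<rho>c[OF w(1)] v(1)] vfix[OF w] by simp
  qed
  have f_D: "f g = \<rho> h *\<^sub>v v" if "g \<in> carrier G" "D g h" for g h
  proof -
    have "D g (SOME h. D g h)" using that(2) by (rule someI)
    then have "\<rho> (SOME h. D g h) *\<^sub>v v = \<rho> h *\<^sub>v v" by (rule well[OF that(1) _ that(2)])
    then show ?thesis using that unfolding f_def by auto
  qed
  have f_0: "f g = 0\<^sub>v d" if "g \<in> carrier G" "\<And>h. \<not> D g h" for g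
    using that unfolding f_def by auto
  have left: "f (h \<otimes> g) = \<rho> h *\<^sub>v f g" if h: "h \<in> H" and g: "g \<in> carrier G" for h g
  proof (cases "\<exists>k. D g k")
    case True
    then obtain k where k: "D g k" by blast
    then have kH: "k \<in> H" by (simp add: D_def)
    have "inv (h \<otimes> k) \<otimes> (h \<otimes> g) = inv k \<otimes> g"
      using h kH g by (simp add: inv_mult_group m_assoc cancel)
    then have "D (h \<otimes> g) (h \<otimes> k)" using h kH k by (simp add: D_def)
    then have "f (h \<otimes> g) = \<rho> (h \<otimes> k) *\<^sub>v v" using f_D h g by simp
    then show ?thesis
      using assoc_mult_mat_vec[OF \<rho>c[OF h] \<rho>c[OF kH] v(1)]
      by (simp add: f_D[OF g k] \<rho>m[OF h kH])
  next
    case False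
    have "\<not> D (h \<otimes> g) k" for k
    proof
      assume k: "D (h \<otimes> g) k"
      then have kH: "k \<in> H" by (simp add: D_def)
      have "inv (inv h \<otimes> k) \<otimes> g = inv k \<otimes> (h \<otimes> g)"
        using h kH g by (simp add: inv_mult_group m_assoc)
      then have "D g (inv h \<otimes> k)" using h kH k by (simp add: D_def)
      with False show False by blast
    qed
    then have "f (h \<otimes> g) = 0\<^sub>v d" "f g = 0\<^sub>v d"
      using f_0 False h g by auto
    moreover have "\<rho> h *\<^sub>v 0\<^sub>v d = 0\<^sub>v d" using \<rho>c[OF h] by (intro eq_vecI) auto
    ultimately show ?thesis by simp
  qed
  have right: "f (g \<otimes> u) = f g" if u: "u \<in> U" and g: "g \<in> carrier G" for u g
  proof -
    have "D (g \<otimes> u) h \<longleftrightarrow> D g h" for h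
    proof (cases "h \<in> H")
      case True
      have e: "inv h \<otimes> (g \<otimes> u) = (inv h \<otimes> g) \<otimes> u"
        using True g u by (simp add: m_assoc)
      have "(inv h \<otimes> g) \<otimes> u \<in> U \<longleftrightarrow> inv h \<otimes> g \<in> U"
      proof
        assume a: "(inv h \<otimes> g) \<otimes> u \<in> U"
        have "inv h \<otimes> g = ((inv h \<otimes> g) \<otimes> u) \<otimes> inv u"
          using True g u by (simp add: m_assoc)
        then show "inv h \<otimes> g \<in> U" using a u by (metis U.m_closed U.m_inv_closed)
      qed (use u in auto)
      then show ?thesis unfolding D_def e by blast
    qed (simp add: D_def)
    then have "D (g \<otimes> u) = D g" by blast
    then show ?thesis using g u by (auto simp: f_def)
  qed
  have "D \<one> \<one>" by (simp add: D_def)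
  then have "f \<one> = v" using f_D[of \<one> \<one>] \<rho>1 v(1) by simp
  moreover have "f \<in> carrier G \<rightarrow>\<^sub>E carrier_vec d"
  proof (rule PiE_I)
    fix g assume g: "g \<in> carrier G"
    show "f g \<in> carrier_vec d"
    proof (cases "\<exists>h. D g h")
      case True
      then obtain h where h: "D g h" by blast
      then show ?thesis using f_D[OF g h] \<rho>c[of h] v(1) by (auto simp: D_def)
    qed (use f_0[OF g] in auto)
  qed (simp add: f_def)
  ultimately show ?thesis
    using left right v(2) unfolding induced_space_def
    by (intro bexI[of _ f] conjI bexI[of _ \<one>] ballI CollectI) auto
qed

section \<open>Reduction modulo the maximal ideal\<close>

interpretation to_resfield: comm_ring_hom "to_resfield :: 'f :: nonarch_local_field o2 \<Rightarrow> 'f resfield"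
proof
  fix c d :: "'f o2"
  obtain x y where xy: "c = abs_o2 x" "d = abs_o2 y"
    by (metis Quotient_abs_rep[OF Quotient_o2])
  show "to_resfield (c + d) = to_resfield c + to_resfield d"
    by (simp add: xy plus_o2.abs_eq plus_resfield.abs_eq)
  show "to_resfield (c * d) = to_resfield c * to_resfield d"
    by (simp add: xy times_o2.abs_eq times_resfield.abs_eq)
qed simp_all

lemma abs_o2_prime_iff: "x \<in> prime_power 1 \<longleftrightarrow> to_resfield (abs_o2 x) = 0"
  by (simp add: zero_resfield_def resfield.abs_eq_iff pcong_def)

lemma to_resfield_unit:
  assumes "to_resfield b \<noteq> 0"
  obtains b' where "b' * b = 1"
proof -
  obtain y where y: "b = abs_o2 y" by (metis Quotient_abs_rep[OF Quotient_o2])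
  have "unit_inverse y * y = 1"
    using assms unfolding y by (intro unit_inverse_mult) (simp only: abs_o2_prime_iff not_False_eq_True)
  then have "abs_o2 (unit_inverse y) * b = 1"
    by (simp add: y times_o2.abs_eq one_o2_def)
  then show thesis by (rule that)
qed

lemma reduction_mult:
  "A \<in> carrier_mat k l \<Longrightarrow> B \<in> carrier_mat l m \<Longrightarrow>
    map_mat to_resfield (A * B) = map_mat to_resfield A * map_mat to_resfield B"
  by (rule to_resfield.mat_hom_mult)

lemma reduction_one: "map_mat to_resfield (1\<^sub>m k) = 1\<^sub>m k"
  by (rule to_resfield.mat_hom_one)

lemma GL_inverse:
  assumes "g \<in> carrier (GL n)"
  shows "inv\<^bsub>GL n\<^esub> g \<in> carrier_mat n n" "inv\<^bsub>GL n\<^esub> g * g = 1\<^sub>m n" "g * inv\<^bsub>GL n\<^esub> g = 1\<^sub>m n"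
  using assms group.l_inv[OF group_GL assms] group.r_inv[OF group_GL assms]
    GL_carrier_mat[OF group.inv_closed[OF group_GL assms]]
  by (simp_all add: mult_GL one_GL)

lemma trace_mult_commute:
  fixes A B :: "'a :: comm_semiring_0 mat"
  assumes "A \<in> carrier_mat m n" "B \<in> carrier_mat n m"
  shows "mat_trace (A * B) = mat_trace (B * A)"
proof -
  have "mat_trace (A * B) = (\<Sum>i<m. \<Sum>k<n. A $$ (i, k) * B $$ (k, i))"
    using assms by (auto simp: mat_trace_def scalar_prod_def atLeast0LessThan intro!: sum.cong)
  also have "\<dots> = (\<Sum>k<n. \<Sum>i<m. B $$ (k, i) * A $$ (i, k))"
    by (subst sum.swap) (simp add: mult.commute)
  also have "\<dots> = mat_trace (B * A)"
    using assms by (auto simp: mat_trace_def scalar_prod_def atLeast0LessThan intro!: sum.cong)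
  finally show ?thesis .
qed

lemma trace_conjugate:
  fixes A X g h :: "'a :: comm_ring_1 mat"
  assumes A: "A \<in> carrier_mat n n" and X: "X \<in> carrier_mat n n"
    and g: "g \<in> carrier_mat n n" and h: "h \<in> carrier_mat n n"
  shows "mat_trace (A * (g * X * h)) = mat_trace (h * A * g * X)"
proof -
  have "A * (g * X * h) = (A * g * X) * h"
    using assms assoc_mult_mat[of A n n "g * X" n h n] assoc_mult_mat[of A n n g n X n] by simp
  also have "mat_trace \<dots> = mat_trace (h * (A * g * X))"
    using assms by (intro trace_mult_commute[of _ n n]) auto
  also have "h * (A * g * X) = h * A * g * X"
    using assms assoc_mult_mat[of h n n "A * g" n X n] assoc_mult_mat[of h n n A n g n] by simp
  finally show ?thesis .
qed

section \<open>Characters of \<open>K1\<close> and their stabilizers\<close>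

lemma K1_carrier: "x \<in> K1 \<Longrightarrow> x \<in> carrier G4"
  by (simp add: K1_def)

lemma K1_normal: "K1 \<lhd> (G4 :: 'f :: nonarch_local_field o2 mat monoid)"
proof -
  interpret G: group "G4 :: 'f o2 mat monoid" by (rule group_GL)
  have red_mult: "map_mat to_resfield (x * y) = map_mat to_resfield x * map_mat to_resfield y"
    if "x \<in> carrier G4" "y \<in> carrier G4" for x y :: "'f o2 mat"
    using that reduction_mult GL_carrier_mat by blast
  have red_inv: "map_mat to_resfield (inv\<^bsub>G4\<^esub> x) = 1\<^sub>m 4"
    if x: "x \<in> carrier G4" "map_mat to_resfield x = 1\<^sub>m 4" for x :: "'f o2 mat"
    using red_mult[OF G.inv_closed[OF x(1)] x(1)] GL_inverse[OF x(1)] x(2)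
    by (simp add: reduction_one)
  show ?thesis
  proof (rule G.normal_invI)
    show "subgroup K1 (G4 :: 'f o2 mat monoid)"
    proof
      show "x \<otimes>\<^bsub>G4\<^esub> y \<in> K1" if "x \<in> K1" "y \<in> K1" for x y :: "'f o2 mat"
        using that G.m_closed[of x y] red_mult[of x y] by (simp add: K1_def mult_GL)
      show "\<one>\<^bsub>G4\<^esub> \<in> (K1 :: 'f o2 mat set)"
        using G.one_closed by (simp add: K1_def one_GL reduction_one)
      show "inv\<^bsub>G4\<^esub> x \<in> K1" if "x \<in> K1" for x :: "'f o2 mat"
        using that red_inv[of x] by (simp add: K1_def)
    qed (simp add: K1_def)
  next
    fix g h :: "'f o2 mat" assume g: "g \<in> carrier G4" and h: "h \<in> K1"
    have hc: "h \<in> carrier G4" "map_mat to_resfield h = 1\<^sub>m 4" using h by (auto simp: K1_def)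
    have gc: "inv\<^bsub>G4\<^esub> g \<in> carrier G4" using g by simp
    have "map_mat to_resfield (g * h * inv\<^bsub>G4\<^esub> g) = map_mat to_resfield (g * inv\<^bsub>G4\<^esub> g)"
      using red_mult[of "g * h" "inv\<^bsub>G4\<^esub> g"] red_mult[of g h] red_mult[of g "inv\<^bsub>G4\<^esub> g"] g gc hc
        G.m_closed[OF g hc(1)] GL_carrier_mat[OF g]
      by (simp add: mult_GL)
    then show "g \<otimes>\<^bsub>G4\<^esub> h \<otimes>\<^bsub>G4\<^esub> inv\<^bsub>G4\<^esub> g \<in> K1"
      using g gc hc G.m_closed[OF G.m_closed[OF g hc(1)] gc] GL_inverse(3)[OF g]
      by (simp add: K1_def mult_GL reduction_one)
  qed
qed

lemma K1_conj:
  assumes "g \<in> carrier G4" "x \<in> K1"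
  shows "g * x * inv\<^bsub>G4\<^esub> g \<in> K1"
  using normal.inv_op_closed2[OF K1_normal assms] by (simp add: mult_GL)

text \<open>
  By cyclicity of the trace, conjugating the argument of \<open>\<psi>\<^sub>\<beta>\<close> amounts to conjugating \<open>\<beta>\<close> in the
  opposite direction.
\<close>

lemma psi_char_conjugate:
  fixes g x :: "'f :: nonarch_local_field o2 mat"
  assumes \<psi>: "additive_character \<psi>" and g: "g \<in> carrier G4" and x: "x \<in> K1"
    and L: "L \<in> carrier_mat 4 4"
  shows "abs_o2 a = mat_trace (inv\<^bsub>G4\<^esub> g * L * g * (x - 1\<^sub>m 4)) \<Longrightarrow>
    psi_char \<psi> (map_mat to_resfield L) (g * x * inv\<^bsub>G4\<^esub> g) = \<psi> a"
proof (rule psi_char_eq[OF \<psi> K1_conj[OF g x] L refl])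
  let ?h = "inv\<^bsub>G4\<^esub> g"
  assume a: "abs_o2 a = mat_trace (?h * L * g * (x - 1\<^sub>m 4))"
  note gc = GL_carrier_mat[OF g] and hc = GL_inverse[OF g]
  have xc: "x \<in> carrier_mat 4 4" using K1_carrier[OF x] by (rule GL_carrier_mat)
  have "g * x * ?h - 1\<^sub>m 4 = g * (x - 1\<^sub>m 4) * ?h"
    using gc hc xc mult_minus_distrib_mat[OF gc xc one_carrier_mat]
      minus_mult_distrib_mat[of "g * x" 4 4 g ?h 4]
    by simp
  then show "abs_o2 a = mat_trace (L * (g * x * ?h - 1\<^sub>m 4))"
    using trace_conjugate[OF L minus_carrier_mat[OF one_carrier_mat] gc hc(1), of x] a by simp
qed

text \<open>
  Conjugating \<open>\<psi>\<^sub>\<beta>\<close> by \<open>g\<close> replaces a lift \<open>L\<close> of \<open>\<beta>\<close> by \<open>g L g\<inverse>\<close>; if the reduction of \<open>g\<close> commutes with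
  \<open>\<beta>\<close>, this is a lift of \<open>\<beta>\<close> again, and the character depends only on \<open>\<beta>\<close>.
\<close>

lemma commuting_mem_stabilizer:
  fixes g L :: "'f :: nonarch_local_field o2 mat"
  assumes \<psi>: "additive_character \<psi>" and g: "g \<in> carrier G4" and L: "L \<in> carrier_mat 4 4"
    and comm: "map_mat to_resfield (g * L) = map_mat to_resfield (L * g)"
  shows "g \<in> stabilizer \<psi> (map_mat to_resfield L)"
proof -
  let ?h = "inv\<^bsub>G4\<^esub> g" and ?r = "map_mat to_resfield"
  interpret G: group "G4 :: 'f o2 mat monoid" by (rule group_GL)
  note gc = GL_carrier_mat[OF g] and hc = GL_inverse[OF g]
  have inv: "inv\<^bsub>G4\<^esub> ?h = g" using g by simp
  have h: "?h \<in> carrier G4" using g by simp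
  have red: "?r (g * L * ?h) = ?r L"
  proof -
    have "?r (g * L * ?h) = ?r (L * g) * ?r ?h"
      using reduction_mult[of "g * L" 4 4 ?h 4] gc hc L comm by simp
    also have "\<dots> = ?r (L * (g * ?h))"
      using reduction_mult[of "L * g" 4 4 ?h 4] gc hc(1) L assoc_mult_mat[OF L gc hc(1)] by simp
    finally show ?thesis using hc L by simp
  qed
  have "psi_char \<psi> (?r L) (?h * x * g) = psi_char \<psi> (?r L) x" if x: "x \<in> K1" for x
  proof -
    obtain a where a: "abs_o2 a = mat_trace (g * L * ?h * (x - 1\<^sub>m 4))"
      by (metis Quotient_abs_rep[OF Quotient_o2])
    have "psi_char \<psi> (?r L) (?h * x * g) = \<psi> a"
      using psi_char_conjugate[OF \<psi> h x L, of a] a by (simp add: inv)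
    also have "\<dots> = psi_char \<psi> (?r L) x"
      using gc hc L by (intro psi_char_eq[OF \<psi> x _ red a, symmetric]) auto
    finally show ?thesis .
  qed
  then show ?thesis using g by (simp add: stabilizer_def mult_GL)
qed

lemma K1_subset_stabilizer:
  fixes \<beta> :: "'f :: nonarch_local_field resfield mat"
  assumes \<psi>: "additive_character \<psi>" and \<beta>: "\<beta> \<in> carrier_mat 4 4"
  shows "K1 \<subseteq> stabilizer \<psi> \<beta>"
proof
  fix x :: "'f o2 mat" assume x: "x \<in> K1"
  define L where "L = map_mat lift_o2 \<beta>"
  have L: "L \<in> carrier_mat 4 4" "map_mat to_resfield L = \<beta>"
    using \<beta> by (auto simp: L_def)
  have xc: "x \<in> carrier_mat 4 4" "map_mat to_resfield x = 1\<^sub>m 4"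
    using x GL_carrier_mat[OF K1_carrier] by (auto simp: K1_def)
  have "map_mat to_resfield (x * L) = map_mat to_resfield (L * x)"
    using reduction_mult[OF xc(1) L(1)] reduction_mult[OF L(1) xc(1)] xc L \<beta> by simp
  then show "x \<in> stabilizer \<psi> \<beta>"
    using commuting_mem_stabilizer[OF \<psi> K1_carrier[OF x] L(1)] L(2) by simp
qed

lemma subgroup_stabilizer:
  fixes \<beta> :: "'f :: nonarch_local_field resfield mat"
  shows "subgroup (stabilizer \<psi> \<beta>) G4"
proof -
  interpret G: group "G4 :: 'f o2 mat monoid" by (rule group_GL)
  interpret K: normal K1 "G4 :: 'f o2 mat monoid" by (rule K1_normal)
  show ?thesis
  proof
    fix g h :: "'f o2 mat" assume g: "g \<in> stabilizer \<psi> \<beta>" and h: "h \<in> stabilizer \<psi> \<beta>"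
    then have c: "g \<in> carrier G4" "h \<in> carrier G4" by (auto simp: stabilizer_def)
    show "g \<otimes>\<^bsub>G4\<^esub> h \<in> stabilizer \<psi> \<beta>"
      unfolding stabilizer_def
    proof (intro CollectI conjI ballI)
      fix x :: "'f o2 mat" assume x: "x \<in> K1"
      let ?y = "inv\<^bsub>G4\<^esub> g \<otimes>\<^bsub>G4\<^esub> x \<otimes>\<^bsub>G4\<^esub> g"
      have y: "?y \<in> K1" using x c by (simp add: K.inv_op_closed1)
      have "inv\<^bsub>G4\<^esub> (g \<otimes>\<^bsub>G4\<^esub> h) \<otimes>\<^bsub>G4\<^esub> x \<otimes>\<^bsub>G4\<^esub> (g \<otimes>\<^bsub>G4\<^esub> h) = inv\<^bsub>G4\<^esub> h \<otimes>\<^bsub>G4\<^esub> ?y \<otimes>\<^bsub>G4\<^esub> h"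
        using c K1_carrier[OF x] by (simp add: G.inv_mult_group G.m_assoc)
      then show "psi_char \<psi> \<beta> (inv\<^bsub>G4\<^esub> (g \<otimes>\<^bsub>G4\<^esub> h) \<otimes>\<^bsub>G4\<^esub> x \<otimes>\<^bsub>G4\<^esub> (g \<otimes>\<^bsub>G4\<^esub> h)) = psi_char \<psi> \<beta> x"
        using g h x y by (simp add: stabilizer_def)
    qed (use c in simp)
  next
    fix g :: "'f o2 mat" assume g: "g \<in> stabilizer \<psi> \<beta>"
    then have c: "g \<in> carrier G4" by (simp add: stabilizer_def)
    show "inv\<^bsub>G4\<^esub> g \<in> stabilizer \<psi> \<beta>"
      unfolding stabilizer_def
    proof (intro CollectI conjI ballI)
      fix x :: "'f o2 mat" assume x: "x \<in> K1"
      let ?y = "g \<otimes>\<^bsub>G4\<^esub> x \<otimes>\<^bsub>G4\<^esub> inv\<^bsub>G4\<^esub> g"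
      have y: "?y \<in> K1" using x c by (simp add: K.inv_op_closed2)
      have "inv\<^bsub>G4\<^esub> g \<otimes>\<^bsub>G4\<^esub> ?y \<otimes>\<^bsub>G4\<^esub> g = x"
        using c K1_carrier[OF x] by (simp add: G.m_assoc G.inv_solve_left')
      then have "psi_char \<psi> \<beta> ?y = psi_char \<psi> \<beta> x"
        using g y by (auto simp: stabilizer_def)
      then show "psi_char \<psi> \<beta> (inv\<^bsub>G4\<^esub> (inv\<^bsub>G4\<^esub> g) \<otimes>\<^bsub>G4\<^esub> x \<otimes>\<^bsub>G4\<^esub> inv\<^bsub>G4\<^esub> g) = psi_char \<psi> \<beta> x"
        using c by simp
    qed (use c in simp)
  next
    show "\<one>\<^bsub>G4\<^esub> \<in> stabilizer \<psi> \<beta>"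
      using K1_carrier by (auto simp: stabilizer_def)
  qed (auto simp: stabilizer_def)
qed

section \<open>Matrices annihilated by an irreducible quadratic polynomial\<close>

lemma less_4_cases: "i < (4::nat) \<longleftrightarrow> i = 0 \<or> i = 1 \<or> i = 2 \<or> i = 3"
  by auto

lemma sum_4: "(\<Sum>k<4. f k) = f 0 + f 1 + f 2 + f (3::nat)" for f :: "nat \<Rightarrow> 'b :: comm_monoid_add"
  by (simp add: eval_nat_numeral)

locale irreducible_quadratic =
  fixes c0 c1 :: "'k :: field"
  assumes no_root: "r * r \<noteq> c1 * r + c0"
begin

definition annihilates :: "nat \<Rightarrow> 'k mat \<Rightarrow> bool" where
  "annihilates n B \<longleftrightarrow> B \<in> carrier_mat n n \<and> B * B = c1 \<cdot>\<^sub>m B + c0 \<cdot>\<^sub>m 1\<^sub>m n"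

lemma square_entry:
  assumes "annihilates n B" "i < n" "j < n"
  shows "(\<Sum>k<n. B $$ (i, k) * B $$ (k, j)) = c1 * B $$ (i, j) + (if i = j then c0 else 0)"
proof -
  have B: "B \<in> carrier_mat n n" and q: "B * B = c1 \<cdot>\<^sub>m B + c0 \<cdot>\<^sub>m 1\<^sub>m n"
    using assms by (auto simp: annihilates_def)
  have "(\<Sum>k<n. B $$ (i, k) * B $$ (k, j)) = (B * B) $$ (i, j)"
    using B assms(2,3) by (auto simp: scalar_prod_def atLeast0LessThan)
  also have "\<dots> = c1 * B $$ (i, j) + (if i = j then c0 else 0)"
    unfolding q using B assms(2,3) by auto
  finally show ?thesis .
qed

text \<open>
  A row or column supported on the diagonal would exhibit the diagonal entry as an eigenvalue, hence
  as a root of the quadratic polynomial.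
\<close>

lemma row_not_diagonal:
  assumes "annihilates n B" "i < n" "\<And>j. j < n \<Longrightarrow> j \<noteq> i \<Longrightarrow> B $$ (i, j) = 0"
  shows False
proof -
  have "(\<Sum>k<n. B $$ (i, k) * B $$ (k, i)) = (\<Sum>k<n. if k = i then B $$ (i, i) * B $$ (i, i) else 0)"
    using assms(3) by (intro sum.cong) auto
  then show False
    using square_entry[OF assms(1,2,2)] no_root[of "B $$ (i, i)"] assms(2) by simp
qed

lemma column_not_diagonal:
  assumes "annihilates n B" "i < n" "\<And>j. j < n \<Longrightarrow> j \<noteq> i \<Longrightarrow> B $$ (j, i) = 0"
  shows False
proof -
  have "(\<Sum>k<n. B $$ (i, k) * B $$ (k, i)) = (\<Sum>k<n. if k = i then B $$ (i, i) * B $$ (i, i) else 0)"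
    using assms(3) by (intro sum.cong) auto
  then show False
    using square_entry[OF assms(1,2,2)] no_root[of "B $$ (i, i)"] assms(2) by simp
qed

lemma annihilates_conjugate:
  assumes B: "annihilates n B" and gh: "g \<in> carrier_mat n n" "h \<in> carrier_mat n n" "g * h = 1\<^sub>m n" "h * g = 1\<^sub>m n"
  shows "annihilates n (h * B * g)"
proof -
  have Bc: "B \<in> carrier_mat n n" and q: "B * B = c1 \<cdot>\<^sub>m B + c0 \<cdot>\<^sub>m 1\<^sub>m n"
    using B by (auto simp: annihilates_def)
  have "g * (h * B * g) = B * g"
    using gh Bc assoc_mult_mat[of g n n h n "B * g" n] assoc_mult_mat[of h n n B n g n] by simp
  then have "(h * B * g) * (h * B * g) = h * B * (B * g)"
    using gh(1,2) Bc assoc_mult_mat[of "h * B" n n g n "h * B * g" n] by simp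
  also have "\<dots> = h * (B * B) * g"
    using gh(1,2) Bc assoc_mult_mat[of h n n "B * B" n g n] assoc_mult_mat[of B n n B n g n]
      assoc_mult_mat[of h n n B n "B * g" n] by simp
  also have "\<dots> = (c1 \<cdot>\<^sub>m (h * B) + c0 \<cdot>\<^sub>m h) * g"
    unfolding q using gh(1,2) Bc
    by (simp add: mult_add_distrib_mat[of h n n _ n] mult_smult_distrib[of h n n _ n])
  also have "\<dots> = c1 \<cdot>\<^sub>m (h * B * g) + c0 \<cdot>\<^sub>m (h * g)"
    using gh(1,2) Bc
    by (simp add: add_mult_distrib_mat[of _ n n _ g n] mult_smult_assoc_mat[of _ n n g n])
  finally show ?thesis
    unfolding gh(4) annihilates_def using gh(1,2) Bc by auto
qed

text \<open>Two copies of the companion matrix of \<open>X\<^sup>2 - c\<^sub>1 X - c\<^sub>0\<close>; this is the form that \<open>\<beta>\<^sub>2\<close> takes.\<close>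

definition companion_sum :: "'k mat" where
  "companion_sum = mat 4 4 (\<lambda>(i, j). if i div 2 \<noteq> j div 2 then 0
     else if even j then (if even i then 0 else 1) else (if even i then c0 else c1))"

lemma companion_sum_carrier [simp]: "companion_sum \<in> carrier_mat 4 4"
  by (simp add: companion_sum_def)

lemma annihilates_companion_sum: "annihilates 4 companion_sum"
  unfolding annihilates_def
proof
  let ?C = companion_sum
  show "?C * ?C = c1 \<cdot>\<^sub>m ?C + c0 \<cdot>\<^sub>m 1\<^sub>m 4"
  proof (rule eq_matI)
    fix i j assume "i < dim_row (c1 \<cdot>\<^sub>m ?C + c0 \<cdot>\<^sub>m 1\<^sub>m 4)" "j < dim_col (c1 \<cdot>\<^sub>m ?C + c0 \<cdot>\<^sub>m 1\<^sub>m 4)"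
    then have ij: "i < 4" "j < 4" by auto
    have "(?C * ?C) $$ (i, j) = (\<Sum>k<4. ?C $$ (i, k) * ?C $$ (k, j))"
      using ij by (auto simp: scalar_prod_def atLeast0LessThan companion_sum_def)
    also have "\<dots> = (c1 \<cdot>\<^sub>m ?C + c0 \<cdot>\<^sub>m 1\<^sub>m 4) $$ (i, j)"
      using ij unfolding less_4_cases
      by (elim disjE) (simp_all add: sum_4 companion_sum_def)
    finally show "(?C * ?C) $$ (i, j) = (c1 \<cdot>\<^sub>m ?C + c0 \<cdot>\<^sub>m 1\<^sub>m 4) $$ (i, j)" .
  qed (simp_all add: companion_sum_def)
qed simp

text \<open>
  The columns are \<open>e\<^sub>1, B e\<^sub>1, e\<^sub>3, B e\<^sub>3\<close>. With respect to such a basis \<open>B\<close> acts as the companion matrix on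
  each of the two cyclic subspaces, so this matrix conjugates \<open>companion_sum\<close> to \<open>B\<close>, provided that it
  is invertible.
\<close>

definition cyclic_basis :: "'k mat \<Rightarrow> 'k mat" where
  "cyclic_basis B = mat 4 4 (\<lambda>(i, j). if even j then (if i = j then 1 else 0) else B $$ (i, j - 1))"

lemma cyclic_basis_carrier [simp]: "cyclic_basis B \<in> carrier_mat 4 4"
  by (simp add: cyclic_basis_def)

lemma cyclic_basis_intertwines:
  assumes B: "annihilates 4 B"
  shows "B * cyclic_basis B = cyclic_basis B * companion_sum"
proof (rule eq_matI)
  let ?M = "cyclic_basis B"
  have Bc: "B \<in> carrier_mat 4 4" using B by (simp add: annihilates_def)
  show "dim_row (B * ?M) = dim_row (?M * companion_sum)" "dim_col (B * ?M) = dim_col (?M * companion_sum)"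
    using Bc by (auto simp: cyclic_basis_def companion_sum_def)
  fix i j assume "i < dim_row (?M * companion_sum)" "j < dim_col (?M * companion_sum)"
  then have ij: "i < 4" "j < 4" by (auto simp: cyclic_basis_def companion_sum_def)
  have "(B * ?M) $$ (i, j) = (\<Sum>k<4. B $$ (i, k) * ?M $$ (k, j))"
    using ij Bc by (auto simp: scalar_prod_def atLeast0LessThan cyclic_basis_def)
  also have "\<dots> = (\<Sum>k<4. ?M $$ (i, k) * companion_sum $$ (k, j))"
  proof (cases "even j")
    case True
    then have j: "j = 0 \<or> j = 2" using ij(2) by (auto simp: less_4_cases)
    then show ?thesis
      using ij unfolding sum_4 by (auto simp: companion_sum_def cyclic_basis_def)
  next
    case False
    then have j: "j = 1 \<or> j = 3" using ij(2) by (auto simp: less_4_cases)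
    then have "(\<Sum>k<4. B $$ (i, k) * ?M $$ (k, j)) = c1 * B $$ (i, j - 1) + (if i = j - 1 then c0 else 0)"
      using square_entry[OF B ij(1), of "j - 1"] ij False by (simp add: cyclic_basis_def)
    also have "\<dots> = (\<Sum>k<4. ?M $$ (i, k) * companion_sum $$ (k, j))"
      using j
    proof
      assume "j = 1"
      then show ?thesis using ij(1) by (simp add: sum_4 companion_sum_def cyclic_basis_def)
    next
      assume "j = 3"
      then show ?thesis using ij(1) by (simp add: sum_4 companion_sum_def cyclic_basis_def)
    qed
    finally show ?thesis .
  qed
  also have "\<dots> = (?M * companion_sum) $$ (i, j)"
    using ij by (auto simp: scalar_prod_def atLeast0LessThan cyclic_basis_def companion_sum_def)
  finally show "(B * ?M) $$ (i, j) = (?M * companion_sum) $$ (i, j)" .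
qed

text \<open>
  For block upper triangular \<open>B\<close> the matrix is upper triangular, with diagonal \<open>1, B\<^bsub>21\<^esub>, 1, B\<^bsub>43\<^esub>\<close>
  in the usual numbering from \<open>1\<close>. These entries do not vanish: otherwise the first column or the last row of \<open>B\<close>
  would be supported on the diagonal.
\<close>

lemma cyclic_basis_triangular:
  assumes B: "annihilates 4 B" and z: "\<And>i j. 2 \<le> i \<Longrightarrow> i < 4 \<Longrightarrow> j < 2 \<Longrightarrow> B $$ (i, j) = 0"
  shows "i < 4 \<Longrightarrow> j < i \<Longrightarrow> cyclic_basis B $$ (i, j) = 0"
    and "i < 4 \<Longrightarrow> cyclic_basis B $$ (i, i) \<noteq> 0"
proof -
  show "cyclic_basis B $$ (i, j) = 0" if "i < 4" "j < i"
  proof (cases "even j")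
    case False
    then have "j = 1" "2 \<le> i" using that by presburger+
    then show ?thesis using that z[of i 0] by (simp add: cyclic_basis_def)
  qed (use that in \<open>simp add: cyclic_basis_def\<close>)
  have "B $$ (1, 0) \<noteq> 0"
  proof
    assume e: "B $$ (1, 0) = 0"
    show False
    proof (rule column_not_diagonal[OF B, of 0])
      show "B $$ (j, 0) = 0" if "j < 4" "j \<noteq> 0" for j
        using that e z[of j 0] by (cases "j = 1") auto
    qed simp
  qed
  moreover have "B $$ (3, 2) \<noteq> 0"
  proof
    assume e: "B $$ (3, 2) = 0"
    show False
    proof (rule row_not_diagonal[OF B, of 3])
      show "B $$ (3, j) = 0" if "j < 4" "j \<noteq> 3" for j
        using that e z[of 3 j] by (cases "j = 2") auto
    qed simp
  qed
  ultimately show "cyclic_basis B $$ (i, i) \<noteq> 0" if "i < 4"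
    using that by (auto simp: less_4_cases cyclic_basis_def)
qed

end

section \<open>The quadratic extension and \<open>\<beta>\<^sub>2\<close>\<close>

lemma mult_matrix_eqI:
  fixes \<iota> :: "'k :: field \<Rightarrow> 'l :: field"
  assumes indep: "\<And>a b a' b'. \<iota> a + \<iota> b * \<eta> = \<iota> a' + \<iota> b' * \<eta> \<Longrightarrow> a = a' \<and> b = b'"
    and A: "A \<in> carrier_mat 2 2"
    and col: "x = \<iota> (A $$ (0, 0)) + \<iota> (A $$ (1, 0)) * \<eta>" "x * \<eta> = \<iota> (A $$ (0, 1)) + \<iota> (A $$ (1, 1)) * \<eta>"
  shows "mult_matrix \<iota> \<eta> x = A"
  unfolding mult_matrix_def
proof (rule the_equality)
  have two: "(\<forall>j<2. P j) \<longleftrightarrow> P 0 \<and> P 1" for P :: "nat \<Rightarrow> bool"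
    by (auto simp: less_2_cases_iff)
  have sum2: "(\<Sum>i<2. f i) = f 0 + f 1" for f :: "nat \<Rightarrow> 'l"
    by (simp add: numeral_2_eq_2)
  show "A \<in> carrier_mat 2 2 \<and> (\<forall>j<2. x * [1, \<eta>] ! j = (\<Sum>i<2. \<iota> (A $$ (i, j)) * [1, \<eta>] ! i))"
    using A col by (simp add: two sum2)
  fix C
  assume C: "C \<in> carrier_mat 2 2 \<and> (\<forall>j<2. x * [1, \<eta>] ! j = (\<Sum>i<2. \<iota> (C $$ (i, j)) * [1, \<eta>] ! i))"
  then have "x * [1, \<eta>] ! 0 = \<iota> (C $$ (0, 0)) * [1, \<eta>] ! 0 + \<iota> (C $$ (1, 0)) * [1, \<eta>] ! 1"
    "x * [1, \<eta>] ! 1 = \<iota> (C $$ (0, 1)) * [1, \<eta>] ! 0 + \<iota> (C $$ (1, 1)) * [1, \<eta>] ! 1"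
    unfolding two sum2 by blast+
  then have "x = \<iota> (C $$ (0, 0)) + \<iota> (C $$ (1, 0)) * \<eta>" "x * \<eta> = \<iota> (C $$ (0, 1)) + \<iota> (C $$ (1, 1)) * \<eta>"
    unfolding nth_Cons_0 One_nat_def nth_Cons_Suc mult_1_right by blast+
  then have "C $$ (0, 0) = A $$ (0, 0) \<and> C $$ (1, 0) = A $$ (1, 0)"
    "C $$ (0, 1) = A $$ (0, 1) \<and> C $$ (1, 1) = A $$ (1, 1)"
    using col indep by metis+
  then show "C = A"
    using A C by (intro eq_matI) (auto simp: less_2_cases_iff)
qed

text \<open>
  Since \<open>\<eta>\<close> generates an extension that is strictly larger than the base field, it lies outside of the
  base field; so \<open>1\<close> and \<open>\<eta>\<close> are independent, and by counting they form a basis. Writing \<open>\<eta>\<^sup>2\<close> in this basis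
  gives the quadratic equation. A root of it in the base field would split it there and put
  \<open>\<eta>\<close> into the base field.
\<close>

lemma beta2_companion:
  fixes \<iota> :: "'k :: {field, finite} \<Rightarrow> 'l :: field"
  assumes hom: "field_hom \<iota>"
    and card: "card (UNIV :: 'l set) = card (UNIV :: 'k set) ^ 2"
    and gen: "generate_field class_ring (insert \<eta> (range \<iota>)) = UNIV"
  shows "\<exists>c0 c1. irreducible_quadratic c0 c1 \<and> beta2 \<iota> \<eta> = irreducible_quadratic.companion_sum c0 c1"
proof -
  interpret field_hom \<iota> by (rule hom)
  let ?q = "card (UNIV :: 'k set)"
  have "card {0, 1 :: 'k} \<le> ?q" by (rule card_mono) auto
  then have q: "1 < ?q" by simp
  have fin: "finite (UNIV :: 'l set)"
    using card q by (intro card_ge_0_finite) simp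
  \<comment> \<open>Otherwise the base field would contain the field generated, which has \<open>q\<^sup>2 > q\<close> elements.\<close>
  have not_base: "\<eta> \<notin> range \<iota>"
  proof
    assume \<eta>: "\<eta> \<in> range \<iota>"
    have "x \<in> range \<iota>" if "x \<in> generate_field class_ring (insert \<eta> (range \<iota>))" for x
      using that
    proof induction
      case one
      have "\<iota> 1 \<in> range \<iota>" by (rule rangeI)
      then show ?case by simp
    next
      case (incl h)
      then show ?case using \<eta> by auto
    next
      case (a_inv h)
      then obtain a where a: "h = \<iota> a" by auto
      have "\<ominus>\<^bsub>class_ring\<^esub> h = \<iota> (- a)"
        by (simp add: a class_ring_simps hom_distribs)
      then show ?case by simp
    next
      case (m_inv h)
      then obtain a where a: "h = \<iota> a" "a \<noteq> 0" by auto
      have "inv\<^bsub>class_ring\<^esub> h = \<iota> (inverse a)"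
        unfolding a(1) by (rule class_cring.comm_inv_char) (use a(2) in \<open>simp_all add: hom_distribs\<close>)
      then show ?case by simp
    next
      case (eng_add h1 h2)
      then obtain a b where "h1 = \<iota> a" "h2 = \<iota> b" by auto
      then have "h1 \<oplus>\<^bsub>class_ring\<^esub> h2 = \<iota> (a + b)" by (simp add: hom_distribs)
      then show ?case by simp
    next
      case (eng_mult h1 h2)
      then obtain a b where "h1 = \<iota> a" "h2 = \<iota> b" by auto
      then have "h1 \<otimes>\<^bsub>class_ring\<^esub> h2 = \<iota> (a * b)" by (simp add: hom_distribs)
      then show ?case by simp
    qed
    then have "range \<iota> = UNIV" using gen by auto
    then have "card (UNIV :: 'l set) \<le> ?q" using card_image_le[of UNIV \<iota>] by simp
    then show False using card q by (simp add: power2_eq_square)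
  qed
  have indep: "a = a' \<and> b = b'" if "\<iota> a + \<iota> b * \<eta> = \<iota> a' + \<iota> b' * \<eta>" for a b a' b'
  proof (cases "b = b'")
    case True
    then show ?thesis using that by simp
  next
    case False
    have "\<iota> (b - b') * \<eta> = \<iota> (a' - a)" using that by (simp add: hom_distribs algebra_simps)
    then have "\<eta> = \<iota> ((a' - a) / (b - b'))"
      using False by (simp add: hom_distribs field_simps)
    then show ?thesis using not_base by blast
  qed
  have "inj (\<lambda>(a, b). \<iota> a + \<iota> b * \<eta>)"
    by (rule injI) (use indep in auto)
  then have "card (range (\<lambda>(a, b). \<iota> a + \<iota> b * \<eta>)) = card (UNIV :: ('k \<times> 'k) set)"
    by (rule card_image)
  also have "\<dots> = card (UNIV :: 'l set)"
    by (simp add: card power2_eq_square card_cartesian_product flip: UNIV_Times_UNIV)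
  finally have "range (\<lambda>(a, b). \<iota> a + \<iota> b * \<eta>) = UNIV"
    using fin by (intro card_subset_eq) auto
  then have "\<eta> * \<eta> \<in> range (\<lambda>(a, b). \<iota> a + \<iota> b * \<eta>)" by simp
  then obtain c0 c1 where c: "\<eta> * \<eta> = \<iota> c0 + \<iota> c1 * \<eta>" by auto
  have irr: "irreducible_quadratic c0 c1"
  proof
    fix r show "r * r \<noteq> c1 * r + c0"
    proof
      assume "r * r = c1 * r + c0"
      then have "\<iota> (r * r) = \<iota> (c1 * r + c0)" by (rule arg_cong)
      then have "\<iota> r * \<iota> r = \<iota> c1 * \<iota> r + \<iota> c0" unfolding hom_mult hom_add .
      then have "(\<eta> - \<iota> r) * (\<eta> - (\<iota> c1 - \<iota> r)) = 0"
        using c by (simp add: algebra_simps)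
      then have "\<eta> = \<iota> r \<or> \<eta> = \<iota> c1 - \<iota> r" unfolding mult_eq_0_iff right_minus_eq .
      then have "\<eta> = \<iota> r \<or> \<eta> = \<iota> (c1 - r)" by (simp add: hom_distribs)
      then show False using not_base by blast
    qed
  qed
  have "mult_matrix \<iota> \<eta> \<eta> = mat_of_rows_list 2 [[0, c0], [1, c1]]"
    by (rule mult_matrix_eqI[OF indep]) (auto simp: mat_of_rows_list_def c)
  moreover have "mult_matrix \<iota> \<eta> 0 = 0\<^sub>m 2 2"
    by (rule mult_matrix_eqI[OF indep]) auto
  ultimately have "beta2 \<iota> \<eta> = irreducible_quadratic.companion_sum c0 c1"
    unfolding beta2_def block_embed_def irreducible_quadratic.companion_sum_def[OF irr]
    by (intro eq_matI)
      (auto simp: mat_of_rows_list_def less_4_cases)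
  then show ?thesis using irr by blast
qed

section \<open>Unipotent matrices\<close>

lemma addrow_mat_mem_K1:
  assumes "i < 4" "j < 4" "i \<noteq> j" "to_resfield c = 0"
  shows "addrow_mat 4 c i j \<in> K1"
proof -
  have "map_mat to_resfield (addrow_mat 4 c i j) = 1\<^sub>m 4"
    using assms by (intro eq_matI) auto
  moreover have "addrow_mat 4 c i j \<in> carrier G4"
    using assms by (intro GL_memI_det[of _ _ 1]) (auto simp: det_addrow_mat)
  ultimately show ?thesis by (simp add: K1_def)
qed

lemma trace_mult_addrow_mat:
  fixes B :: "'a :: comm_ring_1 mat"
  assumes B: "B \<in> carrier_mat n n" and ij: "i < n" "j < n"
  shows "mat_trace (B * (addrow_mat n c i j - 1\<^sub>m n)) = B $$ (j, i) * c"
proof -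
  let ?E = "addrow_mat n c i j - 1\<^sub>m n"
  have E: "?E $$ (k, l) = (if k = i then if l = j then c else 0 else 0)" if "k < n" "l < n" for k l
    using that by auto
  have "mat_trace (B * ?E) = (\<Sum>l<n. \<Sum>k<n. B $$ (l, k) * ?E $$ (k, l))"
    using B by (auto simp: mat_trace_def scalar_prod_def atLeast0LessThan intro!: sum.cong)
  also have "\<dots> = (\<Sum>l<n. \<Sum>k<n. if k = i then if l = j then B $$ (j, i) * c else 0 else 0)"
    by (intro sum.cong refl) (simp add: E)
  also have "\<dots> = B $$ (j, i) * c"
    using ij by simp
  finally show ?thesis .
qed

text \<open>
  For all three partitions the last coordinate of a vector in \<open>M\<^sub>\<lambda>\<close> lies in \<open>\<pp>/\<pp>\<^sup>2\<close>, so \<open>c\<close> in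
  \<open>\<pp>/\<pp>\<^sup>2\<close> annihilates it.
\<close>

lemma addrow_mat_mem_U_inf:
  assumes i: "i < 3" and c: "to_resfield c = 0"
    and \<mu>: "\<mu> \<in> {[2, 1, 1, 1], [2, 2, 1, 1], [2, 2, 2, 1]}"
  shows "addrow_mat 4 c i 3 \<in> U_inf \<mu>"
proof -
  let ?x = "addrow_mat 4 c i 3"
  have fixed: "?x *\<^sub>v v = v" if v: "v \<in> M_inf \<mu>" for v
  proof -
    have vc: "v \<in> carrier_vec 4" and v3: "v $ 3 \<in> abs_o2 ` prime_power (2 - \<mu> ! 3)"
      using v by (auto simp: M_inf_def)
    have "\<mu> ! 3 = 1" using \<mu> by auto
    then obtain y where "v $ 3 = abs_o2 y" "y \<in> prime_power 1"
      using v3 by auto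
    then have "to_resfield (v $ 3) = 0"
      by (simp only: abs_o2_prime_iff)
    then have cv: "c * v $ 3 = 0" using o2_mult_eq_0[OF c] by blast
    show ?thesis
    proof (rule eq_vecI)
      fix k assume "k < dim_vec v"
      then have k: "k < 4" using vc by simp
      have "(?x *\<^sub>v v) $ k = (\<Sum>l<4. ?x $$ (k, l) * v $ l)"
        using k vc by (auto simp: scalar_prod_def atLeast0LessThan)
      also have "\<dots> = (\<Sum>l<4. (if l = k then v $ l else 0) + (if l = 3 then if k = i then c * v $ l else 0 else 0))"
        using k i by (intro sum.cong) (auto simp: algebra_simps)
      also have "\<dots> = v $ k"
        using k cv by (simp add: sum.distrib)
      finally show "(?x *\<^sub>v v) $ k = v $ k" .
    qed (use vc in auto)
  qed
  have "?x \<in> carrier G4"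
    using i c by (intro K1_carrier addrow_mat_mem_K1) auto
  then show ?thesis using fixed by (auto simp: U_inf_def P_inf_def)
qed

lemma U_geom_subgroup:
  "subgroup (U_geom i j) (GL (i + j) :: 'f :: nonarch_local_field o2 mat monoid)"
proof -
  let ?G = "GL (i + j) :: 'f o2 mat monoid"
  interpret G: group ?G by (rule group_GL)
  define u :: "'f o2 mat \<Rightarrow> 'f o2 mat" where
    "u X = four_block_mat (1\<^sub>m i) X (0\<^sub>m j i) (1\<^sub>m j)" for X
  have U: "U_geom i j = {u X | X. X \<in> carrier_mat i j}" by (simp add: U_geom_def u_def)
  have mult: "u X * u Y = u (X + Y)" if "X \<in> carrier_mat i j" "Y \<in> carrier_mat i j" for X Y
    unfolding u_def
    by (subst mult_four_block_mat[of _ i i _ j _ j _ _ i _ j]) (use that comm_add_mat[OF that] in auto)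
  have zero: "u (0\<^sub>m i j) = 1\<^sub>m (i + j)" by (simp add: u_def)
  have uc: "u X \<in> carrier_mat (i + j) (i + j)" if "X \<in> carrier_mat i j" for X
    using that by (auto simp: u_def)
  have inv1: "u X * u (- X) = 1\<^sub>m (i + j)" "u (- X) * u X = 1\<^sub>m (i + j)" if "X \<in> carrier_mat i j" for X
  proof -
    have "X + - X = 0\<^sub>m i j" "- X + X = 0\<^sub>m i j"
      using that by (auto intro!: eq_matI)
    then show "u X * u (- X) = 1\<^sub>m (i + j)" "u (- X) * u X = 1\<^sub>m (i + j)"
      using mult[of X "- X"] mult[of "- X" X] that zero by auto
  qed
  have uG: "u X \<in> carrier ?G" if "X \<in> carrier_mat i j" for X
    by (rule GL_memI[of _ _ "u (- X)"]) (use that uc inv1 in auto)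
  show ?thesis
  proof
    show "U_geom i j \<subseteq> carrier ?G" using uG by (auto simp: U)
    show "x \<otimes>\<^bsub>?G\<^esub> y \<in> U_geom i j" if "x \<in> U_geom i j" "y \<in> U_geom i j" for x y
      using that mult unfolding U mult_GL by (blast intro: add_carrier_mat)
    show "\<one>\<^bsub>?G\<^esub> \<in> U_geom i j" unfolding U one_GL using zero by (auto intro!: exI[of _ "0\<^sub>m i j"])
    show "inv\<^bsub>?G\<^esub> x \<in> U_geom i j" if x: "x \<in> U_geom i j" for x
    proof -
      obtain X where X: "x = u X" "X \<in> carrier_mat i j" using x by (auto simp: U)
      have "inv\<^bsub>?G\<^esub> x = u (- X)"
        by (rule G.inv_equality) (use X uG inv1 in \<open>auto simp: mult_GL one_GL\<close>)
      then show ?thesis using X(2) by (auto simp: U)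
    qed
  qed
qed

lemma addrow_mat_mem_U_geom:
  assumes "i < m" "m \<le> j" "j < m + n"
  shows "addrow_mat (m + n) c i j \<in> U_geom m n"
proof -
  let ?X = "mat m n (\<lambda>(k, l). if k = i \<and> l = j - m then c else 0)"
  have "addrow_mat (m + n) c i j = four_block_mat (1\<^sub>m m) ?X (0\<^sub>m n m) (1\<^sub>m n)"
  proof (rule eq_matI)
    fix k l
    assume "k < dim_row (four_block_mat (1\<^sub>m m) ?X (0\<^sub>m n m) (1\<^sub>m n))"
      "l < dim_col (four_block_mat (1\<^sub>m m) ?X (0\<^sub>m n m) (1\<^sub>m n))"
    then have kl: "k < m + n" "l < m + n" by simp_all
    have "l = j \<longleftrightarrow> \<not> l < m \<and> l - m = j - m" "k = i \<longrightarrow> k < m"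
      using assms by linarith+
    then show "addrow_mat (m + n) c i j $$ (k, l) =
        four_block_mat (1\<^sub>m m) ?X (0\<^sub>m n m) (1\<^sub>m n) $$ (k, l)"
      using kl by (cases "k < m"; cases "l < m") auto
  qed simp_all
  moreover have "?X \<in> carrier_mat m n" by simp
  ultimately show ?thesis unfolding U_geom_def by (intro CollectI exI conjI)
qed

lemma U_geom_conj:
  fixes P u :: "'f :: nonarch_local_field o2 mat"
  assumes P: "P \<in> carrier (GL (m + n))" and low: "\<And>i j. m \<le> i \<Longrightarrow> i < m + n \<Longrightarrow> j < m \<Longrightarrow> P $$ (i, j) = 0"
    and D: "mat n n (\<lambda>(i, j). P $$ (i + m, j + m)) \<in> carrier (GL n)"
    and u: "u \<in> U_geom m n"
  shows "P * u * inv\<^bsub>GL (m + n)\<^esub> P \<in> U_geom m n"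
proof -
  let ?A = "mat m m (\<lambda>(i, j). P $$ (i, j))" and ?B = "mat m n (\<lambda>(i, j). P $$ (i, j + m))"
    and ?D = "mat n n (\<lambda>(i, j). P $$ (i + m, j + m))"
  let ?D' = "inv\<^bsub>GL n\<^esub> ?D"
  note Pc = GL_carrier_mat[OF P] and Pi = GL_inverse[OF P] and Di = GL_inverse[OF D]
  have P_eq: "P = four_block_mat ?A ?B (0\<^sub>m n m) ?D"
    using Pc low by (intro eq_matI) auto
  obtain X where X: "X \<in> carrier_mat m n" "u = four_block_mat (1\<^sub>m m) X (0\<^sub>m n m) (1\<^sub>m n)"
    using u by (auto simp: U_geom_def)
  define Y where "Y = ?A * X * ?D'"
  have A: "?A \<in> carrier_mat m m" and B: "?B \<in> carrier_mat m n" and Dc: "?D \<in> carrier_mat n n"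
    by auto
  have AX: "?A * X \<in> carrier_mat m n" using X(1) by auto
  have Y: "Y \<in> carrier_mat m n" using AX Di(1) by (auto simp: Y_def)
  have YD: "Y * ?D = ?A * X"
    unfolding Y_def using assoc_mult_mat[OF AX Di(1) Dc] Di(2) right_mult_one_mat[OF AX] by simp
  let ?v = "four_block_mat (1\<^sub>m m) Y (0\<^sub>m n m) (1\<^sub>m n)"
  have vc: "?v \<in> carrier_mat (m + n) (m + n)" using Y by auto
  have "P * u = four_block_mat ?A (?A * X + ?B) (0\<^sub>m n m) ?D"
    by (subst P_eq, unfold X(2), subst mult_four_block_mat[OF A B zero_carrier_mat Dc one_carrier_mat X(1) zero_carrier_mat one_carrier_mat])
      (use A B Dc X(1) AX in \<open>simp\<close>)
  also have "?A * X + ?B = ?B + ?A * X" using AX B by (rule comm_add_mat)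
  also have "four_block_mat ?A (?B + ?A * X) (0\<^sub>m n m) ?D = ?v * P"
    by (subst (4) P_eq, subst mult_four_block_mat[OF one_carrier_mat Y zero_carrier_mat one_carrier_mat A B zero_carrier_mat Dc])
      (use A B Dc Y in \<open>simp add: YD\<close>)
  finally have "P * u * inv\<^bsub>GL (m + n)\<^esub> P = ?v"
    using assoc_mult_mat[OF vc Pc Pi(1)] Pi(3) vc by simp
  then show ?thesis using Y by (auto simp: U_geom_def)
qed

section \<open>Twists and tensor products with characters\<close>

lemma tensor_rep_character:
  assumes "\<theta> g \<in> carrier_mat n n" "\<chi> g \<in> carrier_mat 1 1"
  shows "tensor_rep \<theta> \<chi> g = \<chi> g $$ (0, 0) \<cdot>\<^sub>m \<theta> g"
  using assms by (intro eq_matI) (auto simp: tensor_rep_def kronecker_def)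

lemma is_representation_tensor_character:
  fixes G (structure)
  assumes G: "group G" and \<theta>: "is_representation G n \<theta>" and \<chi>: "is_representation G 1 \<chi>"
  shows "is_representation G n (tensor_rep \<theta> \<chi>)"
proof -
  interpret group G by (rule G)
  note \<theta>c = is_representation_carrier[OF \<theta>] and \<chi>c = is_representation_carrier[OF \<chi>]
  let ?\<rho> = "tensor_rep \<theta> \<chi>"
  have \<rho>: "?\<rho> g = \<chi> g $$ (0, 0) \<cdot>\<^sub>m \<theta> g" if "g \<in> carrier G" for g
    using \<theta>c[OF that] \<chi>c[OF that] by (rule tensor_rep_character)
  have \<rho>c: "?\<rho> g \<in> carrier_mat n n" if "g \<in> carrier G" for g
    using \<rho>[OF that] \<theta>c[OF that] by simp
  have mult: "?\<rho> (g \<otimes> h) = ?\<rho> g * ?\<rho> h" if g: "g \<in> carrier G" and h: "h \<in> carrier G" for g h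
  proof -
    have "\<chi> (g \<otimes> h) $$ (0, 0) = \<chi> g $$ (0, 0) * \<chi> h $$ (0, 0)"
      using is_representation_mult[OF \<chi> g h] \<chi>c[OF g] \<chi>c[OF h] by (simp add: scalar_prod_def)
    moreover have "(a * b) \<cdot>\<^sub>m C = b \<cdot>\<^sub>m (a \<cdot>\<^sub>m C)" for a b :: complex and C
      by (intro eq_matI) auto
    ultimately show ?thesis
      using \<theta>c[OF g] \<theta>c[OF h] g h
      by (simp add: \<rho> is_representation_mult[OF \<theta>] mult_smult_distrib[of _ n n _ n]
          mult_smult_assoc_mat[of _ n n _ n])
  qed
  have one: "?\<rho> \<one> = 1\<^sub>m n"
    using \<rho>[OF one_closed] is_representation_one[OF \<theta> G] is_representation_one[OF \<chi> G]
    by (auto intro!: eq_matI)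
  have "?\<rho> g \<in> carrier (GL n)" if g: "g \<in> carrier G" for g
    using mult[OF g inv_closed[OF g]] mult[OF inv_closed[OF g] g] g one
    by (intro GL_memI[OF \<rho>c[OF g] \<rho>c[OF inv_closed[OF g]]]) auto
  then show ?thesis
    unfolding is_representation_def using mult by (intro homI) (auto simp: mult_GL)
qed

text \<open>On elements of determinant \<open>1\<close> a representation agrees with its twists.\<close>

lemma twist_has_fixed_vector:
  assumes \<pi>: "is_representation (GL m) n \<pi>"
    and \<chi>: "\<chi> \<in> hom (units_of (class_ring :: 'a :: comm_ring_1 ring)) (units_of (class_ring :: complex ring))"
    and S: "S \<subseteq> carrier (GL m)" "\<And>s. s \<in> S \<Longrightarrow> det s = 1"
    and U: "S \<subseteq> U" and "has_fixed_vector n (tensor_rep \<pi> (character_rep (\<lambda>g. \<chi> (det g)))) U"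
  shows "has_fixed_vector n \<pi> S"
proof -
  have A: "monoid (class_ring :: 'a ring)" and C: "monoid (class_ring :: complex ring)"
    by (unfold_locales; auto simp: mult.assoc)+
  have "\<chi> 1 = 1"
    using hom_one[OF \<chi> monoid.units_group[OF A] monoid.units_group[OF C]] by (simp add: units_of_one)
  then have eq: "tensor_rep \<pi> (character_rep (\<lambda>g. \<chi> (det g))) s = \<pi> s" if s: "s \<in> S" for s
    using is_representation_carrier[OF \<pi>] S s
    by (subst tensor_rep_character[of _ _ n]) (auto simp: character_rep_def)
  obtain v where v: "v \<in> carrier_vec n" "v \<noteq> 0\<^sub>v n"
    "\<And>u. u \<in> U \<Longrightarrow> tensor_rep \<pi> (character_rep (\<lambda>g. \<chi> (det g))) u *\<^sub>v v = v"
    using assms(6) unfolding has_fixed_vector_def by blast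
  have "\<pi> s *\<^sub>v v = v" if "s \<in> S" for s
    using v(3)[OF subsetD[OF U that]] eq[OF that] by simp
  then show ?thesis
    unfolding has_fixed_vector_def using v(1,2) by blast
qed

lemma trivial_twist:
  assumes \<pi>: "is_representation (GL m) n \<pi>" and U: "U \<subseteq> carrier (GL m)"
  shows "(\<lambda>_. 1) \<in> hom (units_of (class_ring :: 'a :: comm_ring_1 ring)) (units_of (class_ring :: complex ring))"
    and "has_fixed_vector n \<pi> U \<Longrightarrow> has_fixed_vector n (tensor_rep \<pi> (character_rep (\<lambda>_. 1))) U"
proof -
  have "(1 :: complex) \<in> Units class_ring"
    by (auto simp: Units_def)
  then show "(\<lambda>_. 1) \<in> hom (units_of (class_ring :: 'a ring)) (units_of (class_ring :: complex ring))"
    by (intro homI) (auto simp: units_of_def)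
  have eq: "tensor_rep \<pi> (character_rep (\<lambda>_. 1)) u = \<pi> u" if "u \<in> U" for u
    using is_representation_carrier[OF \<pi>] U that
    by (subst tensor_rep_character[of _ _ n]) (auto simp: character_rep_def)
  then show "has_fixed_vector n \<pi> U \<Longrightarrow> has_fixed_vector n (tensor_rep \<pi> (character_rep (\<lambda>_. 1))) U"
    by (simp add: has_fixed_vector_def)
qed

lemma U_geom_det:
  assumes "u \<in> U_geom i j" shows "det u = 1"
proof -
  obtain X where X: "X \<in> carrier_mat i j" "u = four_block_mat (1\<^sub>m i) X (0\<^sub>m j i) (1\<^sub>m j)"
    using assms by (auto simp: U_geom_def)
  have "det u = prod_list (diag_mat u)"
    using X by (intro det_upper_triangular[of _ "i + j"]) (auto simp: upper_triangular_def)
  also have "\<dots> = 1"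
    using X by (auto simp: prod_list_diag_prod intro!: prod.neutral)
  finally show ?thesis .
qed

lemma pulled_back_on_kernel:
  fixes G (structure)
  assumes G: "group G" and N: "subgroup N G" and \<theta>: "is_representation G n \<theta>"
    and pb: "pulled_back G N n \<theta>" and x: "x \<in> N"
  shows "\<theta> x = 1\<^sub>m n"
proof -
  interpret group G by (rule G)
  interpret N: subgroup N G by (rule N)
  obtain \<sigma> where \<sigma>: "\<And>g. g \<in> carrier G \<Longrightarrow> \<theta> g = \<sigma> (N #> g)"
    using pb by (auto simp: pulled_back_def)
  have "\<theta> x = \<theta> \<one>"
    using \<sigma>[of x] \<sigma>[of \<one>] coset_join2[OF _ N, of x] coset_join2[OF _ N, of \<one>] x by simp
  then show ?thesis using is_representation_one[OF \<theta> G] by simp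
qed

section \<open>Invariant functions and the orbit of \<open>\<beta>\<^sub>2\<close>\<close>

text \<open>
  As \<open>b\<close> is a unit, its multiples by \<open>\<pp>/\<pp>\<^sup>2\<close> exhaust \<open>\<pp>/\<pp>\<^sup>2\<close>, and \<open>\<psi>\<close> is nontrivial there.
\<close>

lemma nontrivial_on_multiples:
  assumes \<psi>: "additive_character \<psi>" and b: "to_resfield b \<noteq> 0"
  obtains c a where "to_resfield c = 0" "abs_o2 a = b * c" "\<psi> a \<noteq> 1"
proof -
  obtain b' where b': "b' * b = 1" using to_resfield_unit[OF b] .
  obtain a where a: "a \<in> prime_power 1" "\<psi> a \<noteq> 1"
    using \<psi> by (auto simp: additive_character_def)
  have "to_resfield (abs_o2 a) = 0" using a(1) by (simp only: abs_o2_prime_iff)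
  then have "to_resfield (b' * abs_o2 a) = 0" by (simp add: to_resfield.hom_mult del: to_resfield_abs_o2)
  moreover have "abs_o2 a = b * (b' * abs_o2 a)"
    using b' by (simp add: mult.commute mult.left_commute flip: mult.assoc)
  ultimately show thesis using a(2) that by blast
qed

text \<open>
  For \<open>x = 1 + c E\<^bsub>i j\<^esub>\<close> in \<open>K\<^sub>1\<close>, invariance and the equivariance of \<open>f\<close> on the left give
  \<open>f(g) = f(g x g\<inverse> g) = \<psi>\<^sub>\<beta>(g x g\<inverse>) f(g)\<close>, so \<open>\<psi>\<^sub>\<beta>(g x g\<inverse>) = \<psi>(c B\<^bsub>j i\<^esub>)\<close> is \<open>1\<close> for all \<open>c \<in> \<pp>/\<pp>\<^sup>2\<close>, where \<open>B\<close>
  is the conjugate of \<open>\<beta>\<close> by \<open>g\<close>. This is possible only if \<open>B\<^bsub>j i\<^esub>\<close> vanishes in the residue field.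
\<close>

lemma invariance_kills_entry:
  fixes L g :: "'f :: nonarch_local_field o2 mat"
  assumes \<psi>: "additive_character \<psi>" and L: "L \<in> carrier_mat 4 4" and K: "K1 \<subseteq> H"
    and \<rho>: "\<And>x. x \<in> K1 \<Longrightarrow> \<rho> x = psi_char \<psi> (map_mat to_resfield L) x \<cdot>\<^sub>m 1\<^sub>m d"
    and f: "f \<in> induced_space G4 H d \<rho>" and g: "g \<in> carrier G4" "f g \<noteq> 0\<^sub>v d"
    and ij: "i < 4" "j < 4" "i \<noteq> j"
    and inv: "\<And>c. to_resfield c = 0 \<Longrightarrow> f (g * addrow_mat 4 c i j) = f g"
  shows "map_mat to_resfield (inv\<^bsub>G4\<^esub> g * L * g) $$ (j, i) = 0"
proof (rule ccontr)
  let ?B = "inv\<^bsub>G4\<^esub> g * L * g"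
  note gc = GL_carrier_mat[OF g(1)] and hc = GL_inverse[OF g(1)]
  have B: "?B \<in> carrier_mat 4 4" using gc hc L by auto
  assume "map_mat to_resfield ?B $$ (j, i) \<noteq> 0"
  then have "to_resfield (?B $$ (j, i)) \<noteq> 0" using B gc ij by auto
  then obtain c a where ca: "to_resfield c = 0" "abs_o2 a = ?B $$ (j, i) * c" "\<psi> a \<noteq> 1"
    using nontrivial_on_multiples[OF \<psi>] by blast
  let ?x = "addrow_mat 4 c i j"
  let ?y = "g * ?x * inv\<^bsub>G4\<^esub> g"
  have x: "?x \<in> K1" using addrow_mat_mem_K1 ij ca(1) by blast
  have y: "?y \<in> K1" by (rule K1_conj[OF g(1) x])
  have xc: "?x \<in> carrier_mat 4 4" by simp
  have fc: "f g \<in> carrier_vec d" using f g(1) by (auto simp: induced_space_def)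
  have "?y * g = g * ?x"
    using assoc_mult_mat[OF mult_carrier_mat[OF gc xc] hc(1) gc] hc(2) right_mult_one_mat[OF mult_carrier_mat[OF gc xc]]
    by simp
  then have "f g = f (?y \<otimes>\<^bsub>G4\<^esub> g)" using inv[OF ca(1)] by (simp add: mult_GL)
  also have "\<dots> = \<rho> ?y *\<^sub>v f g" using f g(1) y K by (auto simp: induced_space_def)
  also have "\<rho> ?y = \<psi> a \<cdot>\<^sub>m 1\<^sub>m d"
    using \<rho>[OF y] psi_char_conjugate[OF \<psi> g(1) x L, of a] trace_mult_addrow_mat[OF B ij(1,2)] ca(2)
    by simp
  also have "(\<psi> a \<cdot>\<^sub>m 1\<^sub>m d) *\<^sub>v f g = \<psi> a \<cdot>\<^sub>v f g"
    using fc by (intro eq_vecI) auto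
  finally have e: "f g = \<psi> a \<cdot>\<^sub>v f g" .
  have "f g $ k = 0" if "k < d" for k
  proof -
    have "f g $ k = \<psi> a * f g $ k" using fc that by (subst e) simp
    then show ?thesis using ca(3) by simp
  qed
  then have "f g = 0\<^sub>v d" using fc by (intro eq_vecI) auto
  with g(2) show False by simp
qed

lemma annihilates_orbit:
  fixes g L :: "'f :: nonarch_local_field o2 mat"
  assumes irr: "irreducible_quadratic c0 c1" and L: "L \<in> carrier_mat 4 4"
    and L\<beta>: "map_mat to_resfield L = irreducible_quadratic.companion_sum c0 c1" and g: "g \<in> carrier G4"
  shows "irreducible_quadratic.annihilates c0 c1 4 (map_mat to_resfield (inv\<^bsub>G4\<^esub> g * L * g))"
proof -
  interpret irreducible_quadratic c0 c1 by (rule irr)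
  note gc = GL_carrier_mat[OF g] and hc = GL_inverse[OF g]
  have "map_mat to_resfield (inv\<^bsub>G4\<^esub> g * L * g) =
      map_mat to_resfield (inv\<^bsub>G4\<^esub> g) * companion_sum * map_mat to_resfield g"
    using reduction_mult[OF mult_carrier_mat[OF hc(1) L] gc] reduction_mult[OF hc(1) L] by (simp add: L\<beta>)
  also have "annihilates 4 \<dots>"
    using gc hc reduction_mult[OF gc hc(1)] reduction_mult[OF hc(1) gc]
    by (intro annihilates_conjugate annihilates_companion_sum) (simp_all add: reduction_one)
  finally show ?thesis .
qed

text \<open>
  The vanishing of the lower left block says that \<open>g\<close> maps the plane spanned by the first two
  coordinate vectors to a \<open>\<beta>\<close>-stable plane, which is a line over \<open>\<F>\<^bsub>q\<^sup>2\<^esub>\<close>. The centralizer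
  \<open>GL\<^sub>2(\<F>\<^bsub>q\<^sup>2\<^esub>)\<close> of \<open>\<beta>\<close> acts transitively on such lines, so up to a block upper triangular factor \<open>P\<close>,
  which normalizes \<open>U\<^bsub>2,2\<^esub>\<close>, the element \<open>g\<close> lies in the stabilizer.
\<close>

lemma parabolic_transversal:
  fixes g L :: "'f :: nonarch_local_field o2 mat"
  assumes \<psi>: "additive_character \<psi>" and irr: "irreducible_quadratic c0 c1" and L: "L \<in> carrier_mat 4 4"
    and L\<beta>: "map_mat to_resfield L = irreducible_quadratic.companion_sum c0 c1" and g: "g \<in> carrier G4"
    and low: "\<And>i j. 2 \<le> i \<Longrightarrow> i < 4 \<Longrightarrow> j < 2 \<Longrightarrow> map_mat to_resfield (inv\<^bsub>G4\<^esub> g * L * g) $$ (i, j) = 0"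
  shows "\<exists>P\<in>carrier G4. g * P \<in> stabilizer \<psi> (irreducible_quadratic.companion_sum c0 c1) \<and>
    (\<forall>u\<in>U_geom 2 2. P * u * inv\<^bsub>G4\<^esub> P \<in> U_geom 2 2)"
proof -
  interpret irreducible_quadratic c0 c1 by (rule irr)
  define B where "B = map_mat to_resfield (inv\<^bsub>G4\<^esub> g * L * g)"
  have B: "annihilates 4 B" unfolding B_def by (rule annihilates_orbit[OF irr L L\<beta> g])
  have tri: "i < 4 \<Longrightarrow> j < i \<Longrightarrow> cyclic_basis B $$ (i, j) = 0" "i < 4 \<Longrightarrow> cyclic_basis B $$ (i, i) \<noteq> 0" for i j
    using cyclic_basis_triangular[OF B] low[folded B_def] by blast+
  \<comment> \<open>A lift of \<open>0\<close> need not be \<open>0\<close>, but the lower left block of \<open>P\<close> has to vanish exactly, not just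
    modulo \<open>\<pp>\<close>, for \<open>P\<close> to normalize \<open>U\<^bsub>2,2\<^esub>\<close>.\<close>
  define P :: "'f o2 mat" where
    "P = mat 4 4 (\<lambda>(i, j). if j < i then 0 else lift_o2 (cyclic_basis B $$ (i, j)))"
  have Pc: "P \<in> carrier_mat 4 4" by (simp add: P_def)
  have P_red: "map_mat to_resfield P = cyclic_basis B"
  proof (rule eq_matI)
    fix i j assume "i < dim_row (cyclic_basis B)" "j < dim_col (cyclic_basis B)"
    then have "i < 4" "j < 4" using carrier_matD[OF cyclic_basis_carrier[of B]] by auto
    then show "map_mat to_resfield P $$ (i, j) = cyclic_basis B $$ (i, j)"
      using tri(1)[of i j] by (simp add: P_def)
  qed (use Pc carrier_matD[OF cyclic_basis_carrier[of B]] in auto)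
  have diag: "\<exists>b'. b' * P $$ (i, i) = 1" if "i < 4" for i
    using to_resfield_unit[of "P $$ (i, i)"] tri(2)[OF that] that by (auto simp: P_def)
  have unit: "\<exists>b'. (\<Prod>i\<in>I. P $$ (i, i)) * b' = 1" if "I \<subseteq> {..<4}" for I
  proof -
    obtain b where b: "\<And>i. i < 4 \<Longrightarrow> b i * P $$ (i, i) = 1" using diag by metis
    have "(\<Prod>i\<in>I. P $$ (i, i)) * (\<Prod>i\<in>I. b i) = 1"
      unfolding prod.distrib[symmetric] using b that by (intro prod.neutral) (auto simp: mult.commute)
    then show ?thesis ..
  qed
  have "det P = (\<Prod>i\<in>{..<4}. P $$ (i, i))"
    using det_upper_triangular[OF _ Pc] Pc
    by (auto simp: upper_triangular_def P_def prod_list_diag_prod atLeast0LessThan)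
  then have P: "P \<in> carrier G4"
    using unit[of "{..<4}"] GL_memI_det[OF Pc] by auto
  let ?D = "mat 2 2 (\<lambda>(i, j). P $$ (i + 2, j + 2))"
  have "det ?D = (\<Prod>i\<in>{..<2}. P $$ (i + 2, i + 2))"
    using det_upper_triangular[of ?D 2]
    by (auto simp: upper_triangular_def P_def prod_list_diag_prod atLeast0LessThan)
  also have "\<dots> = (\<Prod>i\<in>{2, 3}. P $$ (i, i))"
    by (simp add: numeral_2_eq_2 numeral_3_eq_3)
  finally have D: "?D \<in> carrier (GL 2)"
    using unit[of "{2, 3}"] GL_memI_det[of ?D 2] by auto
  have conj: "P * u * inv\<^bsub>G4\<^esub> P \<in> U_geom 2 2" if "u \<in> U_geom 2 2" for u
    using U_geom_conj[of P 2 2 u] P D that by (simp add: P_def)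
  define h where "h = g * P"
  have hG: "h \<in> carrier G4" using monoid.m_closed[OF group.is_monoid[OF group_GL] g P] by (simp add: h_def mult_GL)
  note gc = GL_carrier_mat[OF g] and gi = GL_inverse[OF g]
  \<comment> \<open>Modulo \<open>\<pp>\<close> the columns of \<open>h\<close> are \<open>w, \<beta> w, z, \<beta> z\<close>, where \<open>w\<close> and \<open>z\<close> are columns of \<open>g\<close>; this makes
    \<open>h\<close> commute with \<open>\<beta>\<close>.\<close>
  have hH: "h \<in> stabilizer \<psi> companion_sum"
  proof -
    let ?r = "map_mat to_resfield" and ?M = "cyclic_basis B"
    have gB: "?r g * B = ?r L * ?r g"
    proof -
      have "g * (inv\<^bsub>G4\<^esub> g * L * g) = L * g"
        using gc gi L assoc_mult_mat[of g 4 4 "inv\<^bsub>G4\<^esub> g" 4 "L * g" 4]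
          assoc_mult_mat[of "inv\<^bsub>G4\<^esub> g" 4 4 L 4 g 4] by simp
      then show ?thesis
        using reduction_mult[of g 4 4 "inv\<^bsub>G4\<^esub> g * L * g" 4] reduction_mult[OF L gc] gc gi L
        by (simp add: B_def)
    qed
    have Bc: "B \<in> carrier_mat 4 4" using B by (simp add: annihilates_def)
    have rg: "?r g \<in> carrier_mat 4 4" using gc by simp
    have "?r (h * L) = ?r g * ?M * companion_sum"
      using reduction_mult[OF mult_carrier_mat[OF gc Pc] L] reduction_mult[OF gc Pc]
      by (simp add: h_def L\<beta> P_red)
    also have "\<dots> = ?r g * (B * ?M)"
      unfolding cyclic_basis_intertwines[OF B]
      by (rule assoc_mult_mat[OF rg cyclic_basis_carrier companion_sum_carrier])
    also have "\<dots> = ?r L * ?r g * ?M"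
      using assoc_mult_mat[OF rg Bc cyclic_basis_carrier] gB by simp
    also have "\<dots> = ?r (L * h)"
      using reduction_mult[OF L mult_carrier_mat[OF gc Pc]] reduction_mult[OF gc Pc]
        assoc_mult_mat[OF _ rg cyclic_basis_carrier, of "?r L" 4 B] L
      by (simp add: h_def P_red)
    finally show ?thesis
      using commuting_mem_stabilizer[OF \<psi> hG L] by (simp add: L\<beta>)
  qed
  show ?thesis
    using P hH conj unfolding h_def by blast
qed

theorem proposition3p1:
  fixes \<psi> :: "'f :: nonarch_local_field integers \<Rightarrow> complex"
    and \<iota> :: "'f resfield \<Rightarrow> 'l :: field"
    and \<eta> :: 'l
    and \<beta> :: "'f resfield mat"
    and H :: "'f o2 mat set"
    and n d :: nat
    and \<pi> \<rho> \<theta> \<psi>t :: "'f o2 mat \<Rightarrow> complex mat"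
  assumes "additive_character \<psi>"
    and "field_hom \<iota>"
    and "card (UNIV :: 'l set) = card (UNIV :: 'f resfield set) ^ 2"
    and "generate_field class_ring (insert \<eta> (range \<iota>)) = UNIV"
    and "\<beta> = beta2 \<iota> \<eta>"
    and "H = stabilizer \<psi> \<beta>"
    and "irreducible_representation G4 n \<pi>"
    and "\<beta> \<in> orbit \<psi> n \<pi>"
    and "is_representation (G4\<lparr>carrier := H\<rparr>) 1 \<psi>t"
    and "\<And>x. x \<in> K1 \<Longrightarrow> \<psi>t x = character_rep (psi_char \<psi> \<beta>) x"
    and "irreducible_representation (G4\<lparr>carrier := H\<rparr>) d \<theta>"
    and "pulled_back (G4\<lparr>carrier := H\<rparr>) K1 d \<theta>"
    and "\<rho> = tensor_rep \<theta> \<psi>t"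
    and "isomorphic_to_induced G4 n \<pi> H d \<rho>"
  shows "cuspidal n \<pi> \<longleftrightarrow> \<not> has_fixed_vector d \<rho> (H \<inter> U_geom 2 2)"
proof -
  interpret G: group "G4 :: 'f o2 mat monoid" by (rule group_GL)
  obtain c0 c1 where irr: "irreducible_quadratic c0 c1"
    and \<beta>: "\<beta> = irreducible_quadratic.companion_sum c0 c1"
    using beta2_companion[OF assms(2-4)] assms(5) by blast
  interpret irreducible_quadratic c0 c1 by (rule irr)
  note \<psi> = assms(1)
  define L where "L = map_mat lift_o2 \<beta>"
  have \<beta>c: "\<beta> \<in> carrier_mat 4 4" by (simp add: \<beta>)
  have L: "L \<in> carrier_mat 4 4" and L\<beta>: "map_mat to_resfield L = \<beta>"
    using \<beta>c by (auto simp: L_def)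
  have HG: "subgroup H G4" unfolding assms(6) by (rule subgroup_stabilizer)
  interpret H: subgroup H "G4 :: 'f o2 mat monoid" by (rule HG)
  have K1H: "K1 \<subseteq> H" unfolding assms(6) by (rule K1_subset_stabilizer[OF \<psi> \<beta>c])
  have grpH: "group (G4\<lparr>carrier := H\<rparr>)" by (rule G.subgroup_imp_group[OF HG])
  have \<pi>: "is_representation G4 n \<pi>" using assms(7) by (simp add: irreducible_representation_def)
  have \<theta>: "is_representation (G4\<lparr>carrier := H\<rparr>) d \<theta>"
    using assms(11) by (simp add: irreducible_representation_def)
  have \<rho>: "is_representation (G4\<lparr>carrier := H\<rparr>) d \<rho>"
    unfolding assms(13) by (rule is_representation_tensor_character[OF grpH \<theta> assms(9)])
  have \<rho>K: "\<rho> x = psi_char \<psi> (map_mat to_resfield L) x \<cdot>\<^sub>m 1\<^sub>m d" if x: "x \<in> K1" for x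
  proof -
    have "subgroup K1 (G4\<lparr>carrier := H\<rparr>)"
      using G.subgroup_incl[OF normal_imp_subgroup[OF K1_normal] HG K1H] .
    then have "\<theta> x = 1\<^sub>m d" using pulled_back_on_kernel[OF grpH _ \<theta> assms(12) x] by blast
    then show ?thesis
      unfolding assms(13) L\<beta> using assms(10)[OF x]
      by (subst tensor_rep_character[of _ _ d]) (auto simp: character_rep_def)
  qed
  note fixed_iff = has_fixed_vector_iff_induced[OF assms(14) \<pi>]
  have quad: "annihilates 4 (map_mat to_resfield (inv\<^bsub>G4\<^esub> g * L * g))" if "g \<in> carrier G4" for g
    using annihilates_orbit[OF irr L _ that] L\<beta> \<beta> by simp
  have entry: "map_mat to_resfield (inv\<^bsub>G4\<^esub> g * L * g) $$ (j, i) = 0"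
    if "f \<in> induced_space G4 H d \<rho>" "g \<in> carrier G4" "f g \<noteq> 0\<^sub>v d" "i < 4" "j < 4" "i \<noteq> j"
      "\<And>c. to_resfield c = 0 \<Longrightarrow> f (g \<otimes>\<^bsub>G4\<^esub> addrow_mat 4 c i j) = f g" for f g i j
    by (rule invariance_kills_entry[OF \<psi> L K1H \<rho>K that(1-6)]) (use that(7) in \<open>auto simp: mult_GL\<close>)
  have addrow_G: "addrow_mat 4 c i j \<in> carrier G4" if "i < 4" "j < 4" "i \<noteq> j" for c :: "'f o2" and i j
    using that by (intro GL_memI_det[of _ _ 1]) (auto simp: det_addrow_mat)

  \<comment> \<open>Subsets of the groups in question that already have no fixed vector.\<close>
  let ?last = "{addrow_mat 4 c i 3 | (c :: 'f o2) i. i < 3 \<and> to_resfield c = 0}"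
  let ?first = "{addrow_mat 4 c 0 j | (c :: 'f o2) j. 0 < j \<and> j < 4}"
  have lastG: "?last \<subseteq> carrier G4" "\<And>s. s \<in> ?last \<Longrightarrow> det s = 1"
    using addrow_G by (auto simp: det_addrow_mat)
  have firstG: "?first \<subseteq> carrier G4" "\<And>s. s \<in> ?first \<Longrightarrow> det s = 1"
    using addrow_G by (auto simp: det_addrow_mat)
  have no_last: "\<not> has_fixed_vector n \<pi> ?last"
  proof
    assume "has_fixed_vector n \<pi> ?last"
    then obtain f g where f: "f \<in> induced_space G4 H d \<rho>" and g: "g \<in> carrier G4" "f g \<noteq> 0\<^sub>v d"
      and inv: "\<And>u g. u \<in> ?last \<Longrightarrow> g \<in> carrier G4 \<Longrightarrow> f (g \<otimes>\<^bsub>G4\<^esub> u) = f g"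
      unfolding fixed_iff[OF lastG(1)] by blast
    have "map_mat to_resfield (inv\<^bsub>G4\<^esub> g * L * g) $$ (3, i) = 0" if i: "i < 4" "i \<noteq> 3" for i
    proof (rule entry[OF f g i(1) _ i(2)])
      have "i < 3" using i by simp
      then show "f (g \<otimes>\<^bsub>G4\<^esub> addrow_mat 4 c i 3) = f g" if "to_resfield c = 0" for c
        using that by (intro inv g(1)) blast
    qed simp
    then show False using row_not_diagonal[OF quad[OF g(1)], of 3] by auto
  qed
  have no_first: "\<not> has_fixed_vector n \<pi> ?first"
  proof
    assume "has_fixed_vector n \<pi> ?first"
    then obtain f g where f: "f \<in> induced_space G4 H d \<rho>" and g: "g \<in> carrier G4" "f g \<noteq> 0\<^sub>v d"
      and inv: "\<And>u g. u \<in> ?first \<Longrightarrow> g \<in> carrier G4 \<Longrightarrow> f (g \<otimes>\<^bsub>G4\<^esub> u) = f g"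
      unfolding fixed_iff[OF firstG(1)] by blast
    have "map_mat to_resfield (inv\<^bsub>G4\<^esub> g * L * g) $$ (j, 0) = 0" if j: "j < 4" "j \<noteq> 0" for j
    proof (rule entry[OF f g _ j(1) j(2)[symmetric]])
      have "0 < j" using j by simp
      then show "f (g \<otimes>\<^bsub>G4\<^esub> addrow_mat 4 c 0 j) = f g" for c
        using j(1) by (intro inv g(1)) blast
    qed simp
    then show False using column_not_diagonal[OF quad[OF g(1)], of 0] by auto
  qed

  have U22: "subgroup (U_geom 2 2) (G4 :: 'f o2 mat monoid)"
    using U_geom_subgroup[of 2 2] by simp
  interpret U: subgroup "U_geom 2 2" "G4 :: 'f o2 mat monoid" by (rule U22)
  have \<rho>_iff_\<pi>: "has_fixed_vector d \<rho> (H \<inter> U_geom 2 2) \<longleftrightarrow> has_fixed_vector n \<pi> (U_geom 2 2)"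
  proof
    assume "has_fixed_vector d \<rho> (H \<inter> U_geom 2 2)"
    then show "has_fixed_vector n \<pi> (U_geom 2 2)"
      unfolding fixed_iff[OF U.subset] by (rule G.induced_invariant_function[OF HG U22 \<rho>])
  next
    assume "has_fixed_vector n \<pi> (U_geom 2 2)"
    then obtain f g where f: "f \<in> induced_space G4 H d \<rho>" and g: "g \<in> carrier G4" "f g \<noteq> 0\<^sub>v d"
      and inv: "\<And>u g. u \<in> U_geom 2 2 \<Longrightarrow> g \<in> carrier G4 \<Longrightarrow> f (g \<otimes>\<^bsub>G4\<^esub> u) = f g"
      unfolding fixed_iff[OF U.subset] by blast
    have low: "map_mat to_resfield (inv\<^bsub>G4\<^esub> g * L * g) $$ (i, j) = 0" if "2 \<le> i" "i < 4" "j < 2" for i j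
      by (rule entry[OF f g])
        (use that g(1) addrow_mat_mem_U_geom[of j 2 i 2] in \<open>auto intro!: inv\<close>)
    obtain P where P: "P \<in> carrier G4" and "g * P \<in> stabilizer \<psi> companion_sum"
      and conj: "\<And>u. u \<in> U_geom 2 2 \<Longrightarrow> P * u * inv\<^bsub>G4\<^esub> P \<in> U_geom 2 2"
      using parabolic_transversal[OF \<psi> irr L _ g(1) low] L\<beta> \<beta> by metis
    define h where "h = g * P"
    have hH: "h \<in> H" using \<open>g * P \<in> stabilizer \<psi> companion_sum\<close> by (simp add: h_def assms(6) \<beta>)
    \<comment> \<open>Left equivariance moves the nonzero value from \<open>g = h P\<inverse>\<close> to \<open>P\<inverse>\<close>.\<close>
    let ?p = "inv\<^bsub>G4\<^esub> P"
    have p: "?p \<in> carrier G4" using P by simp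
    have "h = g \<otimes>\<^bsub>G4\<^esub> P" by (simp add: h_def mult_GL)
    then have "g = h \<otimes>\<^bsub>G4\<^esub> ?p"
      using g(1) P by (simp add: G.m_assoc)
    then have "f g = \<rho> h *\<^sub>v f ?p"
      using f hH p by (auto simp: induced_space_def)
    moreover have "\<rho> h *\<^sub>v 0\<^sub>v d = 0\<^sub>v d"
      using is_representation_carrier[OF \<rho>, of h] hH by (intro eq_vecI) auto
    ultimately have nz: "f ?p \<noteq> 0\<^sub>v d" using g(2) by auto
    moreover have "f ?p \<in> carrier_vec d" using f p by (auto simp: induced_space_def)
    moreover have "\<rho> u *\<^sub>v f ?p = f ?p" if u: "u \<in> H \<inter> U_geom 2 2" for u
    proof -
      have uG: "u \<in> carrier G4" using u H.subset by blast
      have "\<rho> u *\<^sub>v f ?p = f (u \<otimes>\<^bsub>G4\<^esub> ?p)" using f u p by (auto simp: induced_space_def)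
      also have "u \<otimes>\<^bsub>G4\<^esub> ?p = ?p \<otimes>\<^bsub>G4\<^esub> (P \<otimes>\<^bsub>G4\<^esub> u \<otimes>\<^bsub>G4\<^esub> ?p)"
        using P p uG by (simp flip: G.m_assoc)
      also have "f \<dots> = f ?p" using inv[OF _ p] conj u by (simp add: mult_GL)
      finally show ?thesis .
    qed
    ultimately show "has_fixed_vector d \<rho> (H \<inter> U_geom 2 2)"
      unfolding has_fixed_vector_def by blast
  qed

  show ?thesis
  proof
    assume cusp: "cuspidal n \<pi>"
    have "\<not> has_fixed_vector n (tensor_rep \<pi> (character_rep (\<lambda>_. 1))) (U_geom 2 2)"
      using bspec[OF cusp[unfolded cuspidal_def] trivial_twist(1)[OF \<pi> U.subset]] by (simp add: Let_def)
    then show "\<not> has_fixed_vector d \<rho> (H \<inter> U_geom 2 2)"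
      using trivial_twist(2)[OF \<pi> U.subset] \<rho>_iff_\<pi> by blast
  next
    assume no\<rho>: "\<not> has_fixed_vector d \<rho> (H \<inter> U_geom 2 2)"
    show "cuspidal n \<pi>"
      unfolding cuspidal_def Let_def
    proof (intro ballI conjI)
      fix \<chi> assume \<chi>: "\<chi> \<in> hom (units_of (class_ring :: 'f o2 ring)) (units_of (class_ring :: complex ring))"
      note twist = twist_has_fixed_vector[OF \<pi> \<chi>]
      let ?\<pi> = "tensor_rep \<pi> (character_rep (\<lambda>g. \<chi> (det g)))"
      have "addrow_mat 4 c 0 j \<in> U_geom 1 3" if "0 < j" "j < 4" for c :: "'f o2" and j
        using addrow_mat_mem_U_geom[of 0 1 j 3 c] that by simp
      then have "?first \<subseteq> U_geom 1 3" by blast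
      then have "\<not> has_fixed_vector n ?\<pi> (U_geom 1 3)"
        using twist[OF firstG] no_first by blast
      moreover have "addrow_mat 4 c i 3 \<in> U_geom 3 1" if "i < 3" for c :: "'f o2" and i
        using addrow_mat_mem_U_geom[of i 3 3 1 c] that by simp
      then have "?last \<subseteq> U_geom 3 1" by blast
      then have "\<not> has_fixed_vector n ?\<pi> (U_geom 3 1)"
        using twist[OF lastG] no_last by blast
      moreover have "\<not> has_fixed_vector n ?\<pi> (U_geom 2 2)"
        using twist[OF U.subset U_geom_det[of _ 2 2] order_refl] no\<rho> \<rho>_iff_\<pi> by blast
      ultimately show "case x of (i, j) \<Rightarrow> \<not> has_fixed_vector n ?\<pi> (U_geom i j)"
        if "x \<in> {(1, 3), (2, 2), (3, 1)}" for x
        using that by auto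
      show "\<not> has_fixed_vector n ?\<pi> (U_inf \<mu>)" if \<mu>: "\<mu> \<in> {[2, 1, 1, 1], [2, 2, 1, 1], [2, 2, 2, 1]}" for \<mu>
      proof -
        have "?last \<subseteq> U_inf \<mu>" using addrow_mat_mem_U_inf[OF _ _ \<mu>] by blast
        then show ?thesis using twist[OF lastG] no_last by blast
      qed
    qed
  qed
qed

end
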